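(* (i) Let $A\subset\mathbb{Z}^n$ be a collection of $n+3$ points in general position and let $p$ be a prime. Then the complement in $\mathbb{R}^2$ of the closure of the reduced $p$-adic $A$-discriminant amoeba has no more than $2n^2+9n+11$ connected components. (ii) Moreover, there are a constant $c>0$, an infinite family of positive integers $n$, and, for each $n$ in the family, a support $A_n\subset\mathbb{Z}^n$ of cardinality $n+3$ and a prime $p_n$, such that the complement in $\mathbb{R}^2$ of the closure of the reduced $p_n$-adic $A_n$-discriminant amoeba has at least $c\,n^2$ connected components (i.e. quadratically many in $n$).
   Context: Let $n\ge1$ and let $A=\{a_1,\dots,a_{n+3}\}\subset\mathbb{Z}^n$ be a collection of $n+3$ points. General position means that any $n+1$ of the points are affinely independent. Let $\hat A\in\mathbb{Z}^{(n+1)\times(n+3)}$ be the matrix whose $i$-th column is $\binom{1}{a_i}$, assumed of rank $n+1$, and let $B=(\beta_{i,j})\in\mathbb{Z}^{(n+3)\times 2}$ be an integer matrix whose columns form a basis of the right null space of $\hat A$. Let $p$ be a prime and let $v$ be the $p$-adic valuation on $\mathbb{C}_p$ (the completion of an algebraic closure of $\mathbb{Q}_p$), normalized by $v(p)=1$. For $1\le i\le n+3$ let $f_i(\lambda)=\beta_{i,1}\lambda+\beta_{i,2}$. The reduced $p$-adic $A$-discriminant amoeba is the subset of $\mathbb{R}^2$ $$\left\{\left(\sum_{i=1}^{n+3}\beta_{i,1}\,v(f_i(\lambda)),\ \sum_{i=1}^{n+3}\beta_{i,2}\,v(f_i(\lambda))\right):\ \lambda\in\mathbb{C}_p,\ f_i(\lambda)\neq0\text{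 for all }i\right\}.$$ *)

theory Defs
  imports
    "HOL-Analysis.Analysis"
    "HOL-Computational_Algebra.Computational_Algebra"
    "Jordan_Normal_Form.Matrix_Kernel"
    "Jordan_Normal_Form.DL_Rank"
begin

text \<open>
  Valuations are written additively and real-valued; the value at \<open>0\<close> (mathematically
  \<open>\<infinity>\<close>) is left unspecified and never used.
\<close>

locale padic_valued_field =
  fixes p :: nat and v :: "'k :: field_char_0 \<Rightarrow> real"
  assumes prime_p: "prime p"
    and v_mult: "x \<noteq> 0 \<Longrightarrow> y \<noteq> 0 \<Longrightarrow> v (x * y) = v x + v y"
    and v_add: "x \<noteq> 0 \<Longrightarrow> y \<noteq> 0 \<Longrightarrow> x + y \<noteq> 0 \<Longrightarrow> v (x + y) \<ge> min (v x) (v y)"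
    and v_of_nat: "m > 0 \<Longrightarrow> v (of_nat m) = real (multiplicity p m)"
begin

definition vdist :: "'k \<Rightarrow> 'k \<Rightarrow> real" where
  "vdist x y = (if x = y then 0 else real p powr (- v (x - y)))"

lemma v_minus: 
  assumes "x \<noteq> 0" shows "v (- x) = v x"
proof -
  have "v 1 = 0" using v_mult[of 1 1] by simp
  then have "v (- 1) = 0" using v_mult[of "- 1" "- 1"] by simp
  then show ?thesis using v_mult[of "- 1" x] assms by simp
qed

sublocale Metric_space UNIV vdist
proof
  have p1: "real p > 1" using prime_gt_1_nat[OF prime_p] by simp
  show "0 \<le> vdist x y" for x y by (simp add: vdist_def)
  show "vdist x y = vdist y x" for x y
    using v_minus[of "x - y"] by (auto simp: vdist_def)
  show "(vdist x y = 0) = (x = y)" for x y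
    using p1 by (auto simp: vdist_def)
  show "vdist x z \<le> vdist x y + vdist y z" for x y z
  proof (cases "x = y \<or> y = z \<or> x = z")
    case True
    then show ?thesis by (auto simp: vdist_def)
  next
    case False
    then have "min (v (x - y)) (v (y - z)) \<le> v (x - z)"
      using v_add[of "x - y" "y - z"] by simp
    then have "- v (x - z) \<le> - v (x - y) \<or> - v (x - z) \<le> - v (y - z)" by linarith
    then have "real p powr (- v (x - z)) \<le> real p powr (- v (x - y))
             \<or> real p powr (- v (x - z)) \<le> real p powr (- v (y - z))"
      using p1 by simp
    moreover have "0 \<le> real p powr (- v (x - y))" "0 \<le> real p powr (- v (y - z))" by simp_all
    ultimately have "real p powr (- v (x - z)) \<le>
        real p powr (- v (x - y)) + real p powr (- v (y - z))" by linarith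
    with False show ?thesis by (simp add: vdist_def)
  qed
qed

text \<open>When the field is complete, this closure is a completion of \<open>\<rat>\<close>, i.e. \<open>\<rat>\<^sub>p\<close>.\<close>

definition Qp :: "'k set" where
  "Qp = mtopology closure_of \<rat>"

definition Qp_bar :: "'k set" where
  "Qp_bar = {x. \<exists>P. P \<noteq> 0 \<and> set (coeffs P) \<subseteq> Qp \<and> poly P x = 0}"

end

text \<open>
  \<open>\<complex>\<^sub>p\<close> is only defined up to isomorphism of valued fields (it involves the choice of an
  algebraic closure), so we axiomatise what it means for a field \<open>'k\<close> with valuation \<open>v\<close> to be
  \<open>\<complex>\<^sub>p\<close>: it is complete and contains, as a dense subset, an algebraic closure of the
  completion \<open>\<rat>\<^sub>p\<close> of \<open>\<rat>\<close>. Elements of \<open>Qp_bar\<close> are algebraic over \<open>Qp\<close> by definition, so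
  that \<open>Qp_bar\<close> is an algebraic closure means precisely that it is algebraically closed.
  For each \<open>p\<close> such a \<open>v\<close> exists on any field isomorphic to the complex numbers.
\<close>

locale padic_complex_field = padic_valued_field +
  assumes complete: mcomplete
    and Qp_bar_alg_closed:
      "set (coeffs P) \<subseteq> Qp_bar \<Longrightarrow> degree P > 0 \<Longrightarrow> \<exists>x\<in>Qp_bar. poly P x = 0"
    and Qp_bar_dense: "mtopology closure_of Qp_bar = UNIV"

text \<open>
  Points \<open>a\<^sub>1, \<dots>, a\<^bsub>n+3\<^esub>\<close> are indexed from \<open>0\<close>, as are the rows and columns of matrices.
\<close>

definition A_hat :: "nat \<Rightarrow> (nat \<Rightarrow> int vec) \<Rightarrow> int mat" where
  "A_hat n a = mat (n + 1) (n + 3) (\<lambda>(i, j). if i = 0 then 1 else vec_index (a j) (i - 1))"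

definition is_support :: "nat \<Rightarrow> (nat \<Rightarrow> int vec) \<Rightarrow> bool" where
  "is_support n a \<longleftrightarrow>
     (\<forall>i<n + 3. a i \<in> carrier_vec n) \<and> inj_on a {..<n + 3} \<and>
     vec_space.rank (n + 1) (map_mat rat_of_int (A_hat n a)) = n + 1"

definition affinely_independent :: "nat \<Rightarrow> (nat \<Rightarrow> int vec) \<Rightarrow> nat set \<Rightarrow> bool" where
  "affinely_independent n a S \<longleftrightarrow>
     (\<forall>c :: nat \<Rightarrow> real.
        (\<Sum>i\<in>S. c i) = 0 \<and> (\<forall>k<n. (\<Sum>i\<in>S. c i * of_int (vec_index (a i) k)) = 0)
          \<longrightarrow> (\<forall>i\<in>S. c i = 0))"

definition general_position :: "nat \<Rightarrow> (nat \<Rightarrow> int vec) \<Rightarrow> bool" where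
  "general_position n a \<longleftrightarrow>
     (\<forall>S\<subseteq>{..<n + 3}. card S = n + 1 \<longrightarrow> affinely_independent n a S)"

text \<open>
  The columns form a basis of the null space over \<open>\<rat>\<close>; integer matrices whose columns
  are a \<open>\<int>\<close>-basis of the lattice of integer null vectors are a special case.
\<close>

definition null_space_basis :: "nat \<Rightarrow> (nat \<Rightarrow> int vec) \<Rightarrow> int mat \<Rightarrow> bool" where
  "null_space_basis n a B \<longleftrightarrow>
     B \<in> carrier_mat (n + 3) 2 \<and>
     kernel.basis (n + 3) (map_mat rat_of_int (A_hat n a))
       (set (cols (map_mat rat_of_int B)))"

definition lin_form :: "int mat \<Rightarrow> nat \<Rightarrow> 'k :: field_char_0 \<Rightarrow> 'k" where
  "lin_form B i z = of_int (B $$ (i, 0)) * z + of_int (B $$ (i, 1))"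

definition reduced_amoeba ::
    "nat \<Rightarrow> int mat \<Rightarrow> ('k :: field_char_0 \<Rightarrow> real) \<Rightarrow> (real \<times> real) set" where
  "reduced_amoeba n B v =
     {(\<Sum>i<n + 3. of_int (B $$ (i, 0)) * v (lin_form B i z),
       \<Sum>i<n + 3. of_int (B $$ (i, 1)) * v (lin_form B i z)) | z.
       \<forall>i<n + 3. lin_form B i z \<noteq> 0}"

end

theory Submission
  imports Defs
begin

text \<open>
  Upper bound. For \<open>z\<close> in the field let \<open>S\<close> be the set of those zeros of the linear forms that are
  nearest to \<open>z\<close>. Every other zero \<open>w\<close> satisfies \<open>v (z - w) = v (x - w)\<close> for all \<open>x \<in> S\<close>, so the amoeba
  point of \<open>z\<close> lies on a line that depends on \<open>S\<close> only. The sets \<open>S\<close> form a laminar family, hence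
  there are at most \<open>2 m - 1\<close> of them for \<open>m\<close> zeros. If \<open>m = n + 3\<close>, then the line of the full set
  degenerates to a point because the columns of \<open>B\<close> sum to zero. In any case \<open>2 n + 4\<close> lines and one
  point suffice, and \<open>2 n + 4\<close> lines cut the plane into at most \<open>2 n\<^sup>2 + 9 n + 11\<close> cells.

  Lower bound. The rows \<open>(p, a)\<close> and \<open>(b, p)\<close>, \<open>1 \<le> a, b \<le> k\<close>, yield two pencils of \<open>k\<close> rays each,
  which cross like a grid once four further rows place their vertices suitably. The support with
  these rows as Gale dual has \<open>n = 2 k + 1\<close>, and every sector of one pencil meets every sector of the
  other, so the complement has at least \<open>(k - 1)\<^sup>2\<close> components. Any other basis of the null space
  changes the closed amoeba by a linear automorphism of the plane.
\<close>

section \<open>Regions of a line arrangement\<close>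

lemma card_bool_lists_Cons_le:
  fixes S T U :: "bool list set"
  assumes fin: "finite T" "finite U"
    and tl: "\<And>b bs. b # bs \<in> S \<Longrightarrow> bs \<in> T"
    and both: "\<And>bs. True # bs \<in> S \<Longrightarrow> False # bs \<in> S \<Longrightarrow> bs \<in> U"
    and ne: "[] \<notin> S"
  shows "finite S \<and> card S \<le> card T + card U"
proof -
  let ?S1 = "{bs. True # bs \<in> S}" and ?S2 = "{bs. False # bs \<in> S}"
  have sub: "?S1 \<subseteq> T" "?S2 \<subseteq> T" using tl by auto
  have f1: "finite ?S1" and f2: "finite ?S2"
    using sub fin finite_subset by blast+
  have S: "S = (#) True ` ?S1 \<union> (#) False ` ?S2"
  proof (intro equalityI subsetI)
    fix x assume x: "x \<in> S"
    then obtain b bs where "x = b # bs" using ne by (cases x) auto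
    then show "x \<in> (#) True ` ?S1 \<union> (#) False ` ?S2" using x by (cases b) auto
  qed auto
  have "card S \<le> card ((#) True ` ?S1) + card ((#) False ` ?S2)"
    by (subst S) (rule card_Un_le)
  also have "\<dots> = card ?S1 + card ?S2" by (simp add: card_image inj_on_def)
  also have "\<dots> = card (?S1 \<union> ?S2) + card (?S1 \<inter> ?S2)"
    by (rule card_Un_Int[OF f1 f2])
  also have "\<dots> \<le> card T + card U"
    using both sub fin by (intro add_mono card_mono) auto
  finally show ?thesis using S f1 f2 by (metis finite_Un finite_imageI)
qed

text \<open>The pair \<open>(u, c)\<close> encodes the affine function \<open>x \<mapsto> u \<bullet> x - c\<close>.\<close>

definition sgn_pattern :: "('a::euclidean_space \<times> real) list \<Rightarrow> 'a \<Rightarrow> bool list" where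
  "sgn_pattern gs x = map (\<lambda>(u, c). inner u x - c > 0) gs"

definition generic_pts :: "('a::euclidean_space \<times> real) list \<Rightarrow> 'a set" where
  "generic_pts gs = {x. \<forall>(u, c) \<in> set gs. inner u x - c \<noteq> 0}"

lemma sgn_pattern_segment:
  assumes "x \<in> generic_pts gs" "y \<in> generic_pts gs" "sgn_pattern gs x = sgn_pattern gs y"
    "0 \<le> t" "t \<le> 1"
  shows "(1 - t) *\<^sub>R x + t *\<^sub>R y \<in> generic_pts gs \<and>
    sgn_pattern gs ((1 - t) *\<^sub>R x + t *\<^sub>R y) = sgn_pattern gs x"
proof -
  have key: "inner u ((1 - t) *\<^sub>R x + t *\<^sub>R y) - c \<noteq> 0 \<and>
     (inner u ((1 - t) *\<^sub>R x + t *\<^sub>R y) - c > 0 \<longleftrightarrow> inner u x - c > 0)"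
    if "(u, c) \<in> set gs" for u c
  proof -
    let ?X = "inner u x - c" and ?Y = "inner u y - c"
    have ne: "?X \<noteq> 0" "?Y \<noteq> 0" using assms that by (auto simp: generic_pts_def)
    have eq: "?X > 0 \<longleftrightarrow> ?Y > 0"
      using assms(3) that by (auto simp: sgn_pattern_def)
    have e: "inner u ((1 - t) *\<^sub>R x + t *\<^sub>R y) - c = (1 - t) * ?X + t * ?Y"
      by (simp add: inner_simps algebra_simps)
    consider "t = 0" | "t = 1" | "0 < t" "t < 1" using assms by linarith
    then show ?thesis
    proof cases
      case 3
      show ?thesis
      proof (cases "?X > 0")
        case True
        then have "(1 - t) * ?X + t * ?Y > 0" using eq 3 by (intro add_pos_pos mult_pos_pos) auto
        then show ?thesis using True e by simp
      next
        case False
        then have "(1 - t) * ?X < 0" "t * ?Y < 0" using ne eq 3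
          by (auto intro!: mult_pos_neg)
        then show ?thesis using False e by linarith
      qed
    qed (use eq ne e in auto)
  qed
  then show ?thesis by (auto simp: generic_pts_def sgn_pattern_def)
qed

lemma sgn_pattern_count_Cons:
  assumes X: "convex X"
    and f: "finite (sgn_pattern gs ` (X \<inter> generic_pts gs))"
      "finite (sgn_pattern gs ` (X \<inter> {x. inner u x = c} \<inter> generic_pts gs))"
  shows "finite (sgn_pattern ((u, c) # gs) ` (X \<inter> generic_pts ((u, c) # gs))) \<and>
    card (sgn_pattern ((u, c) # gs) ` (X \<inter> generic_pts ((u, c) # gs)))
    \<le> card (sgn_pattern gs ` (X \<inter> generic_pts gs))
      + card (sgn_pattern gs ` (X \<inter> {x. inner u x = c} \<inter> generic_pts gs))"
proof (rule card_bool_lists_Cons_le[OF f])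
  fix bs
  assume "True # bs \<in> sgn_pattern ((u, c) # gs) ` (X \<inter> generic_pts ((u, c) # gs))"
    "False # bs \<in> sgn_pattern ((u, c) # gs) ` (X \<inter> generic_pts ((u, c) # gs))"
  then obtain x y where x: "x \<in> X" "x \<in> generic_pts ((u, c) # gs)" "inner u x - c > 0"
      "sgn_pattern gs x = bs"
    and y: "y \<in> X" "y \<in> generic_pts ((u, c) # gs)" "\<not> inner u y - c > 0"
      "sgn_pattern gs y = bs"
    by (auto simp: sgn_pattern_def)
  have y2: "inner u y - c < 0" using y by (auto simp: generic_pts_def)
  define t where "t = (inner u x - c) / ((inner u x - c) - (inner u y - c))"
  have t: "0 \<le> t" "t \<le> 1" using x(3) y2 by (auto simp: t_def divide_simps)
  let ?z = "(1 - t) *\<^sub>R x + t *\<^sub>R y"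
  have g: "x \<in> generic_pts gs" "y \<in> generic_pts gs" using x y by (auto simp: generic_pts_def)
  have z: "?z \<in> generic_pts gs" "sgn_pattern gs ?z = bs"
    using sgn_pattern_segment[OF g _ t] x y by auto
  have "?z \<in> X" using X x(1) y(1) t by (simp add: convex_alt)
  moreover have "inner u ?z - c = (inner u x - c) - t * ((inner u x - c) - (inner u y - c))"
    by (simp add: inner_simps algebra_simps)
  then have "inner u ?z = c" using x(3) y2 by (simp add: t_def)
  ultimately show "bs \<in> sgn_pattern gs ` (X \<inter> {x. inner u x = c} \<inter> generic_pts gs)"
    using z by auto
qed (auto simp: sgn_pattern_def generic_pts_def)

lemma sgn_pattern_count_line:
  fixes a :: "'a::euclidean_space"
  shows "finite (sgn_pattern gs ` (range (\<lambda>t. a + t *\<^sub>R w) \<inter> generic_pts gs)) \<and>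
    card (sgn_pattern gs ` (range (\<lambda>t. a + t *\<^sub>R w) \<inter> generic_pts gs)) \<le> length gs + 1"
proof (induction gs)
  case Nil
  have "sgn_pattern [] ` (range (\<lambda>t. a + t *\<^sub>R w) \<inter> generic_pts []) \<subseteq> {[]}"
    by (auto simp: sgn_pattern_def)
  from card_mono[OF _ this] finite_subset[OF this] show ?case by auto
next
  case (Cons g gs)
  obtain u c where g: "g = (u, c)" by (cases g)
  let ?X = "range (\<lambda>t. a + t *\<^sub>R w)"
  have conv: "convex ?X"
    unfolding convex_alt
  proof (intro ballI allI impI)
    fix x y and s :: real assume "x \<in> ?X" "y \<in> ?X"
    then obtain t t' where "x = a + t *\<^sub>R w" "y = a + t' *\<^sub>R w" by auto
    then have "(1 - s) *\<^sub>R x + s *\<^sub>R y = a + ((1 - s) * t + s * t') *\<^sub>R w"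
      by (simp add: algebra_simps)
    then show "(1 - s) *\<^sub>R x + s *\<^sub>R y \<in> ?X" by blast
  qed
  show ?case
  proof (cases "inner u w = 0")
    case False
    let ?z = "a + ((c - inner u a) / inner u w) *\<^sub>R w"
    have s: "?X \<inter> {x. inner u x = c} \<subseteq> {?z}"
    proof
      fix x assume "x \<in> ?X \<inter> {x. inner u x = c}"
      then obtain t where t: "x = a + t *\<^sub>R w" "inner u x = c" by auto
      have "inner u a + t * inner u w = c"
        using t(2) unfolding t(1) inner_add_right inner_scaleR_right .
      then have "(c - inner u a) / inner u w = t" using False by (simp add: field_simps)
      then show "x \<in> {?z}" unfolding t(1) by (simp only: singletonI)
    qed
    have s2: "sgn_pattern gs ` (?X \<inter> {x. inner u x = c} \<inter> generic_pts gs) \<subseteq> {sgn_pattern gs ?z}"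
      using image_mono[OF order_trans[OF inf_le1 s], of "sgn_pattern gs"]
      by (simp only: image_insert image_empty)
    then have "finite (sgn_pattern gs ` (?X \<inter> {x. inner u x = c} \<inter> generic_pts gs))"
      "card (sgn_pattern gs ` (?X \<inter> {x. inner u x = c} \<inter> generic_pts gs)) \<le> 1"
      using finite_subset[OF s2] card_mono[OF _ s2] by auto
    then show ?thesis using sgn_pattern_count_Cons[OF conv, of gs u c] Cons g by auto
  next
    case True
    show ?thesis
    proof (cases "inner u a = c")
      case True
      then have "?X \<inter> generic_pts (g # gs) = {}" using \<open>inner u w = 0\<close>
        by (auto simp: generic_pts_def g inner_simps)
      then show ?thesis by simp
    next
      case False
      then have s: "?X \<inter> {x. inner u x = c} = {}" using \<open>inner u w = 0\<close>
        by (auto simp: inner_simps)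
      show ?thesis using sgn_pattern_count_Cons[OF conv, of gs u c] Cons g unfolding s by auto
    qed
  qed
qed

lemma hyperplane_plane_eq_line:
  fixes u :: "real \<times> real"
  assumes "u \<noteq> 0"
  obtains a w where "{x. inner u x = c} = range (\<lambda>t. a + t *\<^sub>R w)"
proof
  define N where "N = fst u ^ 2 + snd u ^ 2"
  have N: "N \<noteq> 0" using assms by (auto simp: N_def prod_eq_iff sum_power2_eq_zero_iff)
  let ?a = "(c / N) *\<^sub>R u" and ?w = "(- snd u, fst u)"
  show "{x. inner u x = c} = range (\<lambda>t. ?a + t *\<^sub>R ?w)"
  proof (intro equalityI subsetI)
    fix x assume "x \<in> {x. inner u x = c}"
    then have c: "c = fst u * fst x + snd u * snd x" by (cases x; cases u) auto
    define t where "t = (fst u * snd x - snd u * fst x) / N"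
    have "N * (c / N * fst u - t * snd u) = c * fst u - (fst u * snd x - snd u * fst x) * snd u"
      using N by (simp add: t_def field_simps)
    also have "\<dots> = N * fst x" by (simp add: c N_def algebra_simps power2_eq_square)
    finally have 1: "c / N * fst u - t * snd u = fst x" using N by simp
    have "N * (c / N * snd u + t * fst u) = c * snd u + (fst u * snd x - snd u * fst x) * fst u"
      using N by (simp add: t_def field_simps)
    also have "\<dots> = N * snd x" by (simp add: c N_def algebra_simps power2_eq_square)
    finally have 2: "c / N * snd u + t * fst u = snd x" using N by simp
    have "x = ?a + t *\<^sub>R ?w" using 1 2 by (simp add: prod_eq_iff)
    then show "x \<in> range (\<lambda>t. ?a + t *\<^sub>R ?w)" by blast
  next
    fix x assume "x \<in> range (\<lambda>t. ?a + t *\<^sub>R ?w)"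
    then obtain t where x: "x = ?a + t *\<^sub>R ?w" by blast
    have "inner u u = N" by (cases u) (simp add: N_def power2_eq_square)
    moreover have "inner u ?w = 0" by (cases u) simp
    ultimately show "x \<in> {x. inner u x = c}"
      using N by (simp only: x inner_add_right inner_scaleR_right mem_Collect_eq) simp
  qed
qed

lemma sgn_pattern_count_plane:
  fixes gs :: "((real \<times> real) \<times> real) list"
  assumes "\<forall>(u, c) \<in> set gs. u \<noteq> 0"
  shows "finite (sgn_pattern gs ` generic_pts gs) \<and>
    2 * card (sgn_pattern gs ` generic_pts gs) \<le> length gs ^ 2 + length gs + 2"
  using assms
proof (induction gs)
  case Nil
  have sub: "sgn_pattern [] ` (generic_pts [] :: (real \<times> real) set) \<subseteq> {[]}"
    by (auto simp: sgn_pattern_def)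
  from card_mono[OF _ this] finite_subset[OF this] show ?case by auto
next
  case (Cons g gs)
  obtain u c where g: "g = (u, c)" by (cases g)
  have IH: "finite (sgn_pattern gs ` (UNIV \<inter> generic_pts gs))"
    "2 * card (sgn_pattern gs ` (UNIV \<inter> generic_pts gs)) \<le> length gs ^ 2 + length gs + 2"
    using Cons by auto
  have "u \<noteq> 0" using Cons.prems g by auto
  then obtain a w where l: "{x. inner u x = c} = range (\<lambda>t. a + t *\<^sub>R w)"
    by (rule hyperplane_plane_eq_line)
  have L: "finite (sgn_pattern gs ` (UNIV \<inter> {x. inner u x = c} \<inter> generic_pts gs))"
    "card (sgn_pattern gs ` (UNIV \<inter> {x. inner u x = c} \<inter> generic_pts gs)) \<le> length gs + 1"
    unfolding l using sgn_pattern_count_line[of gs a w] by auto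
  have "finite (sgn_pattern (g # gs) ` generic_pts (g # gs)) \<and>
    card (sgn_pattern (g # gs) ` generic_pts (g # gs))
      \<le> card (sgn_pattern gs ` (UNIV \<inter> generic_pts gs)) + (length gs + 1)"
    using sgn_pattern_count_Cons[OF convex_UNIV IH(1) L(1)] L(2) g by auto
  then show ?case using IH(2) by (auto simp: power2_eq_square)
qed

lemma open_sgn_pattern_cell:
  "open {x \<in> generic_pts gs. sgn_pattern gs x = bs}"
proof (cases "{x \<in> generic_pts gs. sgn_pattern gs x = bs} = {}")
  case False
  then obtain y where y: "y \<in> generic_pts gs" "sgn_pattern gs y = bs" by auto
  have "{x \<in> generic_pts gs. sgn_pattern gs x = bs} =
    (\<Inter>(u, c) \<in> set gs. if inner u y - c > 0 then {x. inner u x > c} else {x. inner u x < c})"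
    using y by (fastforce simp: generic_pts_def sgn_pattern_def split: if_splits)
  moreover have "open \<dots>"
    by (intro open_INT) (auto simp: open_halfspace_lt open_halfspace_gt)
  ultimately show ?thesis by simp
qed (simp only: open_empty)

lemma interior_lines_point_empty:
  fixes gs :: "((real \<times> real) \<times> real) list"
  assumes "\<forall>(u, c) \<in> set gs. u \<noteq> 0"
  shows "interior (insert z (- generic_pts gs)) = {}"
  using assms
proof (induction gs)
  case Nil
  then show ?case by (simp add: generic_pts_def)
next
  case (Cons g gs)
  obtain u c where g: "g = (u, c)" by (cases g)
  have "interior {x. inner u x = c} = {}" using Cons.prems g by (auto simp: interior_hyperplane)
  moreover have "interior (insert z (- generic_pts gs)) = {}" using Cons by auto
  ultimately have "interior ({x. inner u x = c} \<union> insert z (- generic_pts gs)) = {}"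
    using interior_closed_Un_empty_interior[OF closed_hyperplane] by metis
  moreover have "insert z (- generic_pts (g # gs)) = {x. inner u x = c} \<union> insert z (- generic_pts gs)"
    by (auto simp: generic_pts_def g)
  ultimately show ?case by simp
qed

lemma card_components_compl_lines:
  fixes gs :: "((real \<times> real) \<times> real) list"
  assumes nz: "\<forall>(u, c) \<in> set gs. u \<noteq> 0" and K: "closed K" "K \<subseteq> insert z (- generic_pts gs)"
  shows "finite (components (- K)) \<and> 2 * card (components (- K)) \<le> length gs ^ 2 + length gs + 2"
proof -
  have "\<exists>x. x \<in> C \<and> x \<noteq> z \<and> x \<in> generic_pts gs" if "C \<in> components (- K)" for C
  proof -
    have "open C" "C \<noteq> {}" using that K open_components in_components_nonempty by blast+
    then have "\<not> C \<subseteq> insert z (- generic_pts gs)"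
      using interior_lines_point_empty[OF nz, of z] interior_maximal by blast
    then show ?thesis by blast
  qed
  then obtain f where f: "\<And>C. C \<in> components (- K) \<Longrightarrow> f C \<in> C \<and> f C \<noteq> z \<and> f C \<in> generic_pts gs"
    by metis
  let ?h = "\<lambda>C. sgn_pattern gs (f C)"
  have inj: "inj_on ?h (components (- K))"
  proof (rule inj_onI)
    fix C D assume CD: "C \<in> components (- K)" "D \<in> components (- K)" "?h C = ?h D"
    define E where "E = {x \<in> generic_pts gs. sgn_pattern gs x = ?h C}"
    have "convex E" unfolding convex_alt E_def using sgn_pattern_segment by fastforce
    moreover have "open E" unfolding E_def by (rule open_sgn_pattern_cell)
    ultimately have conn: "connected (E - {z})"
      by (intro connected_open_delete convex_connected) auto
    have sub: "E - {z} \<subseteq> - K" using K by (auto simp: E_def)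
    have "f C \<in> E - {z}" "f D \<in> E - {z}" using f CD by (auto simp: E_def)
    then have "E - {z} \<subseteq> C" "E - {z} \<subseteq> D" "E - {z} \<noteq> {}"
      using components_maximal[OF _ conn sub] f CD by blast+
    then show "C = D" using components_eq CD by blast
  qed
  have im: "?h ` components (- K) \<subseteq> sgn_pattern gs ` generic_pts gs" using f by auto
  note cnt = sgn_pattern_count_plane[OF nz]
  have "finite (components (- K))"
    using finite_subset[OF im] cnt inj finite_imageD by blast
  moreover have "card (components (- K)) \<le> card (sgn_pattern gs ` generic_pts gs)"
    using card_inj_on_le[OF inj im] cnt by blast
  ultimately show ?thesis using cnt by linarith
qed

section \<open>Clusters of zeros and the upper bound\<close>

lemma laminar_card_bound:
  assumes "finite X" "F \<subseteq> Pow X" "{} \<notin> F"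
    and "\<And>S T. S \<in> F \<Longrightarrow> T \<in> F \<Longrightarrow> S \<inter> T = {} \<or> S \<subseteq> T \<or> T \<subseteq> S"
  shows "card F \<le> 2 * card X - 1"
  using assms
proof (induction X arbitrary: F rule: finite_induct)
  case empty
  then have "F = {}" by auto
  then show ?case by simp
next
  case (insert x X)
  have finF: "finite F" using insert.prems(1) insert.hyps(1) finite_subset by fastforce
  show ?case
  proof (cases "X = {}")
    case True
    then have "F \<subseteq> Pow {x} - {{}}" using insert.prems by blast
    also have "\<dots> = {{x}}" by (auto simp: Pow_insert)
    finally have "F \<subseteq> {{x}}" .
    then show ?thesis using card_mono[of "{{x}}" F] True by simp
  next
    case False
    define F1 where "F1 = {S \<in> F. S \<noteq> {x}}"
    define D where "D = {S \<in> F1. x \<in> S \<and> S - {x} \<in> F1}"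
    define G where "G = (\<lambda>S. S - {x}) ` F1"
    have "card G \<le> 2 * card X - 1"
    proof (rule insert.IH)
      show "G \<subseteq> Pow X" using insert.prems(1) by (auto simp: G_def F1_def)
      show "{} \<notin> G"
      proof
        assume "{} \<in> G"
        then obtain S where "S \<in> F" "S \<noteq> {x}" "S - {x} = {}" by (auto simp: G_def F1_def)
        then show False using insert.prems(2) by (metis Diff_eq_empty_iff subset_singletonD)
      qed
      show "S \<inter> T = {} \<or> S \<subseteq> T \<or> T \<subseteq> S" if ST: "S \<in> G" "T \<in> G" for S T
      proof -
        obtain S' T' where "S' \<in> F" "T' \<in> F" "S = S' - {x}" "T = T' - {x}"
          using ST unfolding G_def F1_def by blast
        then show ?thesis using insert.prems(3)[of S' T'] by blast
      qed
    qed
    moreover have "card D \<le> 1"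
    proof -
      have "S = T" if "S \<in> D" "T \<in> D" for S T
      proof -
        have *: "S \<subseteq> T" if "S \<in> D" "T \<in> D" "S \<inter> T - {x} \<noteq> {}" "T \<subseteq> S" for S T
        proof -
          have "S - {x} \<in> F" "T \<in> F" "x \<in> T" using that by (auto simp: D_def F1_def)
          then show ?thesis using insert.prems(3)[of "S - {x}" T] that by blast
        qed
        have m: "S \<in> F" "T \<in> F" "x \<in> S" "x \<in> T" "S - {x} \<in> F" "T - {x} \<in> F"
          using that by (auto simp: D_def F1_def)
        then have ne: "S - {x} \<noteq> {}" "T - {x} \<noteq> {}" using insert.prems(2) by metis+
        have "S \<subseteq> T \<or> T \<subseteq> S" using insert.prems(3)[of S T] m by blast
        then show ?thesis using *[of S T] *[of T S] that ne by blast
      qed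
      moreover have "finite D" using finF by (simp add: D_def F1_def)
      ultimately show ?thesis using card_le_Suc0_iff_eq[of D] by auto
    qed
    moreover have "card (F1 - D) \<le> card G"
    proof (rule card_inj_on_le)
      show "inj_on (\<lambda>S. S - {x}) (F1 - D)"
      proof (rule inj_onI)
        fix S T assume a: "S \<in> F1 - D" "T \<in> F1 - D" "S - {x} = T - {x}"
        show "S = T"
        proof (cases "x \<in> S \<longleftrightarrow> x \<in> T")
          case True then show ?thesis using a(3) by blast
        next
          case False
          then have "x \<in> S \<and> S - {x} = T \<or> x \<in> T \<and> T - {x} = S" using a(3) by blast
          then have "S \<in> D \<or> T \<in> D" unfolding D_def using a(1,2) by (metis DiffD1 mem_Collect_eq)
          then show ?thesis using a(1,2) by blast
        qed
      qed
      show "(\<lambda>S. S - {x}) ` (F1 - D) \<subseteq> G" by (auto simp: G_def)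
      show "finite G" using finF by (simp add: G_def F1_def)
    qed
    moreover have "card F \<le> card (F1 - D) + card D + 1"
    proof -
      have "F \<subseteq> insert {x} ((F1 - D) \<union> D)" by (auto simp: F1_def)
      moreover have fin: "finite ((F1 - D) \<union> D)" using finF by (simp add: F1_def D_def)
      ultimately have "card F \<le> card (insert {x} ((F1 - D) \<union> D))" by (intro card_mono) auto
      also have "\<dots> \<le> Suc (card ((F1 - D) \<union> D))" 
        using fin by (simp add: card_insert_if)
      also have "\<dots> \<le> Suc (card (F1 - D) + card D)" using card_Un_le by blast
      finally show ?thesis by simp
    qed
    moreover have "card X \<ge> 1" using False insert.hyps by (simp add: Suc_leI card_gt_0_iff)
    ultimately show ?thesis using insert.hyps by simp
  qed
qed

context padic_valued_field
begin

lemma v_1: "v 1 = 0"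
  using v_mult[of 1 1] by simp

lemma v_diff_commute: "v (x - y) = v (y - x)"
  by (cases "x = y") (use v_minus[of "x - y"] in auto)

lemma v_add_eq:
  assumes "x \<noteq> 0" "y \<noteq> 0" "v x < v y"
  shows "x + y \<noteq> 0" "v (x + y) = v x"
proof -
  show ne: "x + y \<noteq> 0"
  proof
    assume "x + y = 0"
    then have "y = - x" by (metis add.commute add_eq_0_iff)
    then show False using v_minus[of x] assms by simp
  qed
  have "v x \<ge> min (v (x + y)) (v y)"
    using v_add[of "x + y" "- y"] v_minus[of y] ne assms by simp
  moreover have "v (x + y) \<ge> min (v x) (v y)" using v_add assms ne by blast
  ultimately show "v (x + y) = v x" using assms by linarith
qed

lemma v_diff_ge:
  assumes "x \<noteq> y" "y \<noteq> z" "x \<noteq> z"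
  shows "v (x - z) \<ge> min (v (x - y)) (v (y - z))"
  using v_add[of "x - y" "y - z"] assms by simp

lemma v_diff_eq:
  assumes "x \<noteq> y" "y \<noteq> z" "v (x - y) < v (y - z)"
  shows "v (x - z) = v (x - y)"
  using v_add_eq[of "x - y" "y - z"] assms by simp

definition cluster :: "'k set \<Rightarrow> 'k set \<Rightarrow> bool" where
  "cluster L S \<longleftrightarrow> S \<subseteq> L \<and> S \<noteq> {} \<and>
     (\<forall>x\<in>S. \<forall>y\<in>S. \<forall>w\<in>L - S. x \<noteq> y \<longrightarrow> v (x - w) < v (x - y))"

lemma cluster_laminar:
  assumes "cluster L S" "cluster L T"
  shows "S \<inter> T = {} \<or> S \<subseteq> T \<or> T \<subseteq> S"
proof (rule ccontr)
  assume "\<not> ?thesis"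
  then obtain x y z where "x \<in> S" "x \<in> T" "y \<in> S" "y \<notin> T" "z \<in> T" "z \<notin> S" by blast
  then have "v (x - z) < v (x - y)" "v (x - y) < v (x - z)"
    using assms unfolding cluster_def by (metis DiffI subsetD)+
  then show False by simp
qed

lemma card_clusters:
  assumes "finite L" and "F \<subseteq> {S. cluster L S}"
  shows "finite F \<and> card F \<le> 2 * card L - 1"
proof
  have F: "F \<subseteq> Pow L" using assms by (auto simp: cluster_def)
  then show "finite F" using assms(1) finite_subset by blast
  show "card F \<le> 2 * card L - 1"
  proof (rule laminar_card_bound[OF assms(1) F])
    show "{} \<notin> F" using assms by (auto simp: cluster_def)
  qed (use cluster_laminar assms in blast)
qed

definition cuts_out :: "'k set \<Rightarrow> 'k set \<Rightarrow> 'k \<Rightarrow> real \<Rightarrow> bool" where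
  "cuts_out L S z r \<longleftrightarrow> (\<forall>x\<in>S. v (z - x) = r) \<and> (\<forall>x\<in>S. \<forall>w\<in>L - S. v (z - w) = v (x - w))"

lemma ex_cluster_cuts_out:
  assumes "finite L" "L \<noteq> {}" "z \<notin> L"
  obtains S r where "cluster L S" "cuts_out L S z r"
proof
  define r where "r = Max ((\<lambda>x. v (z - x)) ` L)"
  define S where "S = {x \<in> L. v (z - x) = r}"
  have le: "v (z - x) \<le> r" if "x \<in> L" for x using assms that by (simp add: r_def)
  have "r \<in> (\<lambda>x. v (z - x)) ` L" unfolding r_def using assms by (intro Max_in) auto
  then have ne: "S \<noteq> {}" by (auto simp: S_def)
  have out: "v (z - w) = v (x - w)" and lt: "v (x - w) < r" if "x \<in> S" "w \<in> L - S" for x w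
  proof -
    have "v (z - w) < v (z - x)" using le[of w] that by (force simp: S_def)
    moreover have "w \<noteq> z" "z \<noteq> x" using that assms by (auto simp: S_def)
    ultimately have "v (w - x) = v (w - z)" using v_diff_eq[of w z x] v_diff_commute[of w z] by simp
    then show "v (z - w) = v (x - w)" using v_diff_commute by metis
    then show "v (x - w) < r" using \<open>v (z - w) < v (z - x)\<close> that by (simp add: S_def)
  qed
  have "v (x - y) \<ge> r" if "x \<in> S" "y \<in> S" "x \<noteq> y" for x y
    using v_diff_ge[of x z y] v_diff_commute[of x z] that assms by (auto simp: S_def)
  then show "cluster L S" using ne lt unfolding cluster_def by (force simp: S_def)
  show "cuts_out L S z r" using out by (auto simp: cuts_out_def S_def)
qed

lemma sum_cuts_out:
  fixes c :: "'k \<Rightarrow> 'b::real_vector"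
  assumes "finite L" "cluster L S" "cuts_out L S z r" "x \<in> S"
  shows "(\<Sum>m\<in>L. v (z - m) *\<^sub>R c m) = r *\<^sub>R (\<Sum>m\<in>S. c m) + (\<Sum>m\<in>L - S. v (x - m) *\<^sub>R c m)"
proof -
  have "S \<subseteq> L" using assms by (simp add: cluster_def)
  then have "(\<Sum>m\<in>L. v (z - m) *\<^sub>R c m) =
      (\<Sum>m\<in>L - S. v (z - m) *\<^sub>R c m) + (\<Sum>m\<in>S. v (z - m) *\<^sub>R c m)"
    using assms by (intro sum.subset_diff) auto
  moreover have "(\<Sum>m\<in>S. v (z - m) *\<^sub>R c m) = (\<Sum>m\<in>S. r *\<^sub>R c m)"
    using assms by (intro sum.cong) (auto simp: cuts_out_def)
  moreover have "(\<Sum>m\<in>L - S. v (z - m) *\<^sub>R c m) = (\<Sum>m\<in>L - S. v (x - m) *\<^sub>R c m)"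
    using assms by (intro sum.cong) (auto simp: cuts_out_def)
  ultimately show ?thesis by (simp add: scaleR_sum_right)
qed

lemma cluster_line:
  fixes c :: "'k \<Rightarrow> real \<times> real"
  assumes "finite L" "cluster L S"
  shows "\<exists>g. fst g \<noteq> 0 \<and> (\<forall>z r. cuts_out L S z r \<longrightarrow>
    inner (fst g) (P + (\<Sum>m\<in>L. v (z - m) *\<^sub>R c m)) = snd g)"
proof -
  obtain x where x: "x \<in> S" using assms by (auto simp: cluster_def)
  let ?w = "\<Sum>m\<in>S. c m"
  obtain u where u: "u \<noteq> 0" "inner u ?w = 0"
  proof (cases "?w = 0")
    case True
    then show ?thesis using that[of "(1, 0)"] by (simp add: zero_prod_def)
  next
    case False
    then show ?thesis using that[of "(- snd ?w, fst ?w)"] by (cases ?w) (auto simp: zero_prod_def)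
  qed
  have "inner u (P + (\<Sum>m\<in>L. v (z - m) *\<^sub>R c m)) = inner u (P + (\<Sum>m\<in>L - S. v (x - m) *\<^sub>R c m))"
    if "cuts_out L S z r" for z r
    unfolding sum_cuts_out[OF assms that x] by (simp add: inner_add_right u)
  then show ?thesis using u by (intro exI[of _ "(u, inner u (P + (\<Sum>m\<in>L - S. v (x - m) *\<^sub>R c m)))"]) auto
qed

lemma valuation_curve_lines:
  fixes c :: "'k \<Rightarrow> real \<times> real"
  assumes L: "finite L"
  obtains gs where "\<forall>(u, d) \<in> set gs. u \<noteq> 0"
    "length gs \<le> 2 * card L - (if sum c L = 0 then 2 else 1)"
    "\<And>z. z \<notin> L \<Longrightarrow> P + (\<Sum>m\<in>L. v (z - m) *\<^sub>R c m) \<in> insert P (- generic_pts gs)"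
proof -
  define F where "F = {S. cluster L S} - (if sum c L = 0 then {L} else {})"
  have clL: "cluster L L" if "L \<noteq> {}" using that by (auto simp: cluster_def)
  have finC: "finite {S. cluster L S}" using card_clusters[OF L order_refl] by blast
  have F: "finite F" "F \<subseteq> {S. cluster L S}"
    using card_clusters[OF L, of F] by (auto simp: F_def)
  have cF: "card F \<le> 2 * card L - (if sum c L = 0 then 2 else 1)"
  proof (cases "sum c L = 0 \<and> L \<noteq> {}")
    case True
    then have "card F = card {S. cluster L S} - 1" using finC clL by (simp add: F_def)
    then show ?thesis using card_clusters[OF L order_refl] True by auto
  next
    case False
    then show ?thesis using card_clusters[OF L F(2)] by auto
  qed
  have "\<forall>S\<in>F. \<exists>g. fst g \<noteq> 0 \<and> (\<forall>z r. cuts_out L S z r \<longrightarrow>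
      inner (fst g) (P + (\<Sum>m\<in>L. v (z - m) *\<^sub>R c m)) = snd g)"
    using cluster_line[OF L] F by blast
  then obtain h where h: "\<And>S. S \<in> F \<Longrightarrow> fst (h S) \<noteq> 0"
    "\<And>S z r. S \<in> F \<Longrightarrow> cuts_out L S z r \<Longrightarrow>
        inner (fst (h S)) (P + (\<Sum>m\<in>L. v (z - m) *\<^sub>R c m)) = snd (h S)" by metis
  obtain xs where xs: "set xs = F" "distinct xs" using F(1) finite_distinct_list by blast
  show ?thesis
  proof (rule that[of "map h xs"])
    show "\<forall>(u, d)\<in>set (map h xs). u \<noteq> 0" using h(1) xs by (auto simp: case_prod_beta)
    show "length (map h xs) \<le> 2 * card L - (if sum c L = 0 then 2 else 1)"
      using cF xs distinct_card[of xs] by simp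
    fix z assume z: "z \<notin> L"
    let ?Q = "P + (\<Sum>m\<in>L. v (z - m) *\<^sub>R c m)"
    show "?Q \<in> insert P (- generic_pts (map h xs))"
    proof (cases "L = {}")
      case False
      then obtain S r where S: "cluster L S" "cuts_out L S z r"
        using ex_cluster_cuts_out L z by blast
      show ?thesis
      proof (cases "S \<in> F")
        case True
        then have "inner (fst (h S)) ?Q - snd (h S) = 0" using h(2) S by simp
        moreover have "h S \<in> set (map h xs)" using True xs by simp
        ultimately have "?Q \<notin> generic_pts (map h xs)"
          unfolding generic_pts_def by (metis (mono_tags, lifting) case_prod_unfold mem_Collect_eq)
        then show ?thesis by simp
      next
        case False
        then have "S = L" "sum c L = 0" using S by (auto simp: F_def split: if_splits)
        moreover obtain x where "x \<in> S" using S by (auto simp: cluster_def)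
        ultimately have "?Q = P" using sum_cuts_out[OF L S, of x c] by simp
        then show ?thesis by simp
      qed
    qed simp
  qed
qed

lemma reduced_amoeba_lines:
  assumes col0: "(\<Sum>i<n + 3. B $$ (i, 0)) = 0" and col1: "(\<Sum>i<n + 3. B $$ (i, 1)) = 0"
  obtains gs P where "\<forall>(u, d) \<in> set gs. u \<noteq> 0" "length gs \<le> 2 * n + 4"
    "reduced_amoeba n B v \<subseteq> insert P (- generic_pts gs)"
proof -
  define I where "I = {i. i < n + 3 \<and> B $$ (i, 0) \<noteq> 0}"
  define J where "J = {i. i < n + 3 \<and> B $$ (i, 0) = 0}"
  define b where "b i = (real_of_int (B $$ (i, 0)), real_of_int (B $$ (i, 1)))" for i
  define \<mu> where "\<mu> i = - (of_int (B $$ (i, 1)) / of_int (B $$ (i, 0)) :: 'k)" for i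
  define L where "L = \<mu> ` I"
  define c where "c m = (\<Sum>i\<in>{i \<in> I. \<mu> i = m}. b i)" for m
  define P where "P = (\<Sum>i\<in>I. v (of_int (B $$ (i, 0))) *\<^sub>R b i)
     + (\<Sum>i\<in>J. v (of_int (B $$ (i, 1))) *\<^sub>R b i)"
  have IJ: "{..<n + 3} = I \<union> J" "I \<inter> J = {}" "finite I" "finite J"
    by (auto simp: I_def J_def)
  have L: "finite L" "card L \<le> card I" using IJ by (auto simp: L_def card_image_le)
  have group: "(\<Sum>i\<in>I. f (\<mu> i) *\<^sub>R b i) = (\<Sum>m\<in>L. f m *\<^sub>R c m)" for f :: "'k \<Rightarrow> real"
  proof -
    have "(\<Sum>i\<in>I. f (\<mu> i) *\<^sub>R b i) = (\<Sum>m\<in>L. \<Sum>i\<in>{i \<in> I. \<mu> i = m}. f (\<mu> i) *\<^sub>R b i)"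
      unfolding L_def by (rule sum.image_gen[OF IJ(3)])
    also have "\<dots> = (\<Sum>m\<in>L. f m *\<^sub>R c m)"
      unfolding c_def by (intro sum.cong) (auto simp: scaleR_sum_right)
    finally show ?thesis .
  qed
  have "sum c L = sum b I" using group[of "\<lambda>_. 1"] by simp
  have bsum: "sum b {..<n + 3} = 0"
    using col0 col1 unfolding b_def sum_prod by (simp flip: of_int_sum add: zero_prod_def)
  obtain gs where gs: "\<forall>(u, d) \<in> set gs. u \<noteq> 0"
    "length gs \<le> 2 * card L - (if sum c L = 0 then 2 else 1)"
    "\<And>z. z \<notin> L \<Longrightarrow> P + (\<Sum>m\<in>L. v (z - m) *\<^sub>R c m) \<in> insert P (- generic_pts gs)"
    using valuation_curve_lines[OF L(1), of c P] by blast
  have "card I + card J = n + 3" using IJ card_Un_disjoint[of I J] by (metis card_lessThan)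
  have len: "length gs \<le> 2 * n + 4"
  proof (cases "J = {}")
    case True
    then have "sum c L = 0" using bsum IJ \<open>sum c L = sum b I\<close> by simp
    then show ?thesis using gs(2) L \<open>card I + card J = n + 3\<close> True by simp
  next
    case False
    then have "card J \<ge> 1" using IJ by (simp add: Suc_leI card_gt_0_iff)
    then show ?thesis using gs(2) L \<open>card I + card J = n + 3\<close> by (simp split: if_splits)
  qed
  have "reduced_amoeba n B v \<subseteq> insert P (- generic_pts gs)"
  proof
    fix q assume "q \<in> reduced_amoeba n B v"
    then obtain z where z: "\<forall>i<n + 3. lin_form B i z \<noteq> 0"
      and q: "q = (\<Sum>i<n + 3. of_int (B $$ (i, 0)) * v (lin_form B i z),
       \<Sum>i<n + 3. of_int (B $$ (i, 1)) * v (lin_form B i z))"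
      unfolding reduced_amoeba_def by blast
    have "q = (\<Sum>i<n + 3. v (lin_form B i z) *\<^sub>R b i)"
      unfolding q b_def by (simp add: sum_prod mult.commute)
    also have "\<dots> = (\<Sum>i\<in>I. v (lin_form B i z) *\<^sub>R b i) + (\<Sum>i\<in>J. v (lin_form B i z) *\<^sub>R b i)"
      unfolding IJ(1) using IJ by (intro sum.union_disjoint) auto
    also have "(\<Sum>i\<in>J. v (lin_form B i z) *\<^sub>R b i) = (\<Sum>i\<in>J. v (of_int (B $$ (i, 1))) *\<^sub>R b i)"
      by (intro sum.cong) (auto simp: J_def lin_form_def)
    also have "(\<Sum>i\<in>I. v (lin_form B i z) *\<^sub>R b i) =
       (\<Sum>i\<in>I. v (of_int (B $$ (i, 0))) *\<^sub>R b i + v (z - \<mu> i) *\<^sub>R b i)"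
    proof (intro sum.cong refl)
      fix i assume i: "i \<in> I"
      then have e: "lin_form B i z = of_int (B $$ (i, 0)) * (z - \<mu> i)"
        by (simp add: lin_form_def \<mu>_def I_def field_simps)
      have "lin_form B i z \<noteq> 0" using z i by (simp add: I_def)
      then have "v (lin_form B i z) = v (of_int (B $$ (i, 0))) + v (z - \<mu> i)"
        unfolding e by (intro v_mult) auto
      then show "v (lin_form B i z) *\<^sub>R b i = v (of_int (B $$ (i, 0))) *\<^sub>R b i + v (z - \<mu> i) *\<^sub>R b i"
        by (simp add: scaleR_add_left)
    qed
    also have "\<dots> = (\<Sum>i\<in>I. v (of_int (B $$ (i, 0))) *\<^sub>R b i) + (\<Sum>m\<in>L. v (z - m) *\<^sub>R c m)"
      by (simp add: sum.distrib group[of "\<lambda>m. v (z - m)"])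
    finally have "q = P + (\<Sum>m\<in>L. v (z - m) *\<^sub>R c m)" by (simp add: P_def)
    moreover have "z \<notin> L"
    proof
      assume "z \<in> L"
      then obtain i where "i \<in> I" "z = \<mu> i" by (auto simp: L_def)
      then have "lin_form B i z = 0" "i < n + 3" by (auto simp: lin_form_def \<mu>_def I_def)
      then show False using z by blast
    qed
    ultimately show "q \<in> insert P (- generic_pts gs)" using gs(3) by simp
  qed
  then show ?thesis using that gs len by blast
qed

lemma closure_reduced_amoeba_lines:
  assumes "(\<Sum>i<n + 3. B $$ (i, 0)) = 0" and "(\<Sum>i<n + 3. B $$ (i, 1)) = 0"
  obtains gs P where "\<forall>(u, d) \<in> set gs. u \<noteq> 0" "length gs \<le> 2 * n + 4"
    "closure (reduced_amoeba n B v) \<subseteq> insert P (- generic_pts gs)"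
proof -
  obtain gs P where g: "\<forall>(u, d) \<in> set gs. u \<noteq> 0" "length gs \<le> 2 * n + 4"
    "reduced_amoeba n B v \<subseteq> insert P (- generic_pts gs)"
    using reduced_amoeba_lines[OF assms] by blast
  have "generic_pts gs = (\<Inter>(u, c)\<in>set gs. - {x. inner u x = c})"
    by (auto simp: generic_pts_def)
  moreover have "open \<dots>"
    by (intro open_INT) (auto simp: closed_hyperplane open_Compl)
  ultimately have "open (generic_pts gs)" by simp
  then have "closed (insert P (- generic_pts gs))" by (intro closed_insert closed_Compl)
  then show ?thesis using that g closure_minimal by metis
qed

end

lemma null_space_basis_col_sum:
  assumes "null_space_basis n a B" "j < 2"
  shows "(\<Sum>i<n + 3. B $$ (i, j)) = 0"
proof -
  let ?A = "map_mat rat_of_int (A_hat n a)" and ?B = "map_mat rat_of_int B"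
  have A: "?A \<in> carrier_mat (n + 1) (n + 3)" by (simp add: A_hat_def)
  interpret kernel "n + 1" "n + 3" ?A by unfold_locales (rule A)
  have B: "B \<in> carrier_mat (n + 3) 2" and "Ker.basis (set (cols ?B))"
    using assms unfolding null_space_basis_def by auto
  then have "col ?B j \<in> mat_kernel ?A"
    using assms(2) unfolding Ker.basis_def by (auto simp: cols_def)
  then have "?A *\<^sub>v col ?B j = 0\<^sub>v (n + 1)" using mat_kernelD[OF A] by blast
  then have "(?A *\<^sub>v col ?B j) $ 0 = 0" by simp
  moreover have "(?A *\<^sub>v col ?B j) $ 0 = (\<Sum>i<n + 3. rat_of_int (B $$ (i, j)))"
    using B assms(2) by (auto simp: A_hat_def scalar_prod_def lessThan_atLeast0 intro!: sum.cong)
  ultimately show ?thesis by (simp flip: of_int_sum)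
qed

lemma card_components_amoeba_le:
  fixes v :: "'k :: field_char_0 \<Rightarrow> real"
  assumes "null_space_basis n a B" "padic_valued_field p v"
  shows "finite (components (- closure (reduced_amoeba n B v))) \<and>
    card (components (- closure (reduced_amoeba n B v))) \<le> 2 * n ^ 2 + 9 * n + 11"
proof -
  interpret padic_valued_field p v by fact
  obtain gs P where gs: "\<forall>(u, d) \<in> set gs. u \<noteq> 0" "length gs \<le> 2 * n + 4"
    "closure (reduced_amoeba n B v) \<subseteq> insert P (- generic_pts gs)"
    using closure_reduced_amoeba_lines[where n = n and B = B] null_space_basis_col_sum[OF assms(1)] by auto
  note c = card_components_compl_lines[OF gs(1) closed_closure gs(3)]
  have "length gs ^ 2 + length gs + 2 \<le> (2 * n + 4) ^ 2 + (2 * n + 4) + 2"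
    using gs(2) by (intro add_mono power_mono) auto
  also have "\<dots> = 2 * (2 * n ^ 2 + 9 * n + 11)" by (simp add: power2_eq_square algebra_simps)
  finally have "2 * card (components (- closure (reduced_amoeba n B v))) \<le> 2 * (2 * n ^ 2 + 9 * n + 11)"
    by (rule order_trans[OF conjunct2[OF c]])
  then have "card (components (- closure (reduced_amoeba n B v))) \<le> 2 * n ^ 2 + 9 * n + 11"
    by (simp only: nat_mult_le_cancel_disj)
  then show ?thesis using c by blast
qed

section \<open>Cones, rays and Gale duality\<close>

definition ray :: "real \<times> real \<Rightarrow> real \<times> real \<Rightarrow> (real \<times> real) set" where
  "ray P u = {P + s *\<^sub>R u | s. 0 \<le> s}"

definition cone_at :: "real \<times> real \<Rightarrow> real \<times> real \<Rightarrow> real \<times> real \<Rightarrow> (real \<times> real) set" where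
  "cone_at P u w = {P + s *\<^sub>R u + t *\<^sub>R w | s t. 0 < s \<and> 0 < t}"

definition cross2 :: "real \<times> real \<Rightarrow> real \<times> real \<Rightarrow> real" where
  "cross2 x y = fst x * snd y - snd x * fst y"

lemma cross2_coords:
  assumes "cross2 u w \<noteq> 0"
  shows "x = P + s *\<^sub>R u + t *\<^sub>R w \<longleftrightarrow>
    s = cross2 (x - P) w / cross2 u w \<and> t = cross2 u (x - P) / cross2 u w" (is "?l \<longleftrightarrow> ?r")
proof
  assume ?l
  then have "cross2 (x - P) w = s * cross2 u w" "cross2 u (x - P) = t * cross2 u w"
    by (simp_all add: cross2_def algebra_simps)
  then show ?r using assms by simp
next
  assume ?r
  then have s: "s * cross2 u w = cross2 (x - P) w" and t: "t * cross2 u w = cross2 u (x - P)"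
    using assms by auto
  have "cross2 u w * (s * fst u + t * fst w) = cross2 u w * fst (x - P)"
    "cross2 u w * (s * snd u + t * snd w) = cross2 u w * snd (x - P)"
    using arg_cong[OF s, of "\<lambda>y. y * fst u"] arg_cong[OF t, of "\<lambda>y. y * fst w"]
      arg_cong[OF s, of "\<lambda>y. y * snd u"] arg_cong[OF t, of "\<lambda>y. y * snd w"]
    by (simp_all add: cross2_def algebra_simps)
  then have "s * fst u + t * fst w = fst (x - P)" "s * snd u + t * snd w = snd (x - P)"
    using assms by (metis mult_left_cancel)+
  then show ?l by (simp add: prod_eq_iff)
qed

lemma
  assumes "cross2 u w \<noteq> 0"
  shows open_cone_at: "open (cone_at P u w)"
    and frontier_cone_at: "frontier (cone_at P u w) \<subseteq> ray P u \<union> ray P w"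
proof -
  let ?s = "\<lambda>x. cross2 (x - P) w / cross2 u w" and ?t = "\<lambda>x. cross2 u (x - P) / cross2 u w"
  have c: "continuous_on UNIV ?s" "continuous_on UNIV ?t"
    unfolding cross2_def using assms by (auto intro!: continuous_intros simp: cross2_def)
  have eq: "cone_at P u w = {x. 0 < ?s x} \<inter> {x. 0 < ?t x}"
    using cross2_coords[OF assms, of _ P] by (auto simp: cone_at_def)
  then show op: "open (cone_at P u w)"
    using c by (simp add: open_Int open_Collect_less)
  have "closed ({x. 0 \<le> ?s x} \<inter> {x. 0 \<le> ?t x})"
    using c by (intro closed_Int closed_Collect_le) auto
  then have cl: "closure (cone_at P u w) \<subseteq> {x. 0 \<le> ?s x} \<inter> {x. 0 \<le> ?t x}"
    by (intro closure_minimal) (auto simp: eq)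
  show "frontier (cone_at P u w) \<subseteq> ray P u \<union> ray P w"
  proof
    fix x assume "x \<in> frontier (cone_at P u w)"
    then have "x \<in> closure (cone_at P u w)" "x \<notin> cone_at P u w"
      using op by (simp_all add: frontier_def interior_open)
    then have "0 \<le> ?s x" "0 \<le> ?t x" "\<not> (0 < ?s x \<and> 0 < ?t x)"
      using cl eq by blast+
    then have "?s x = 0 \<or> ?t x = 0" by linarith
    moreover have "x = P + ?s x *\<^sub>R u + ?t x *\<^sub>R w" using cross2_coords[OF assms] by blast
    ultimately obtain s t where st: "x = P + s *\<^sub>R u + t *\<^sub>R w" "0 \<le> s" "0 \<le> t" "s = 0 \<or> t = 0"
      using \<open>0 \<le> ?s x\<close> \<open>0 \<le> ?t x\<close> by blast
    from st(4) show "x \<in> ray P u \<union> ray P w"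
    proof
      assume "s = 0"
      then have "x = P + t *\<^sub>R w" using st(1) by simp
      then show ?thesis using st(3) unfolding ray_def by blast
    next
      assume "t = 0"
      then have "x = P + s *\<^sub>R u" using st(1) by simp
      then show ?thesis using st(2) unfolding ray_def by blast
    qed
  qed
qed

lemma components_of_grid:
  fixes U V :: "'i \<Rightarrow> 'a::euclidean_space set"
  assumes K: "interior K = {}" and fin: "finite I"
    and open_UV: "\<And>i. i \<in> I \<Longrightarrow> open (U i)" "\<And>i. i \<in> I \<Longrightarrow> open (V i)"
    and fr: "\<And>i. i \<in> I \<Longrightarrow> frontier (U i) \<subseteq> K" "\<And>i. i \<in> I \<Longrightarrow> frontier (V i) \<subseteq> K"
    and disj: "disjoint_family_on U I" "disjoint_family_on V I"
    and meet: "\<And>i j. i \<in> I \<Longrightarrow> j \<in> I \<Longrightarrow> U i \<inter> V j \<noteq> {}"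
  shows "\<exists>C \<subseteq> components (- K). finite C \<and> card C = card I ^ 2"
proof -
  have "\<exists>x. x \<in> U i \<inter> V j \<and> x \<notin> K" if "i \<in> I" "j \<in> I" for i j
  proof -
    have "open (U i \<inter> V j)" using open_UV that by auto
    then have "\<not> U i \<inter> V j \<subseteq> K" using K meet[OF that] interior_maximal by blast
    then show ?thesis by blast
  qed
  then obtain x where x: "\<And>i j. i \<in> I \<Longrightarrow> j \<in> I \<Longrightarrow> x i j \<in> U i \<inter> V j \<and> x i j \<notin> K" by metis
  define f where "f = (\<lambda>(i, j). connected_component_set (- K) (x i j))"
  have comp: "f (i, j) \<in> components (- K)" and self: "x i j \<in> f (i, j)"
    and sub: "f (i, j) \<subseteq> U i \<inter> V j" if "i \<in> I" "j \<in> I" for i j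
  proof -
    show "f (i, j) \<in> components (- K)" using x[OF that] by (simp add: f_def componentsI)
    show s: "x i j \<in> f (i, j)" using x[OF that] by (simp add: f_def)
    have conn: "connected (f (i, j))" and nK: "f (i, j) \<subseteq> - K"
      unfolding f_def using connected_component_subset[of "- K"] by auto
    have "f (i, j) \<subseteq> T" if "x i j \<in> T" "frontier T \<subseteq> K" for T
      using connected_Int_frontier[OF conn, of T] s nK that by blast
    then show "f (i, j) \<subseteq> U i \<inter> V j" using x[OF that] fr that by blast
  qed
  have "inj_on f (I \<times> I)"
  proof (rule inj_onI, clarify)
    fix i j i' j' assume a: "i \<in> I" "j \<in> I" "i' \<in> I" "j' \<in> I" "f (i, j) = f (i', j')"
    then have "x i j \<in> U i \<inter> U i'" "x i j \<in> V j \<inter> V j'"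
      using self[of i j] sub[of i j] sub[of i' j'] by auto
    then show "i = i' \<and> j = j'" using disj a unfolding disjoint_family_on_def by blast
  qed
  then have "card (f ` (I \<times> I)) = card I ^ 2"
    by (simp add: card_image card_cartesian_product power2_eq_square)
  moreover have "f ` (I \<times> I) \<subseteq> components (- K)" using comp by auto
  ultimately show ?thesis using fin by (intro exI[of _ "f ` (I \<times> I)"]) auto
qed

lemma ray_subset_closure:
  assumes "\<And>q. q \<in> \<rat> \<Longrightarrow> 0 < q \<Longrightarrow> P + q *\<^sub>R u \<in> S"
  shows "ray P u \<subseteq> closure S"
proof
  fix x assume "x \<in> ray P u"
  then obtain s where s: "x = P + s *\<^sub>R u" "0 \<le> s" by (auto simp: ray_def)
  show "x \<in> closure S" unfolding closure_approachable
  proof (intro allI impI)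
    fix e :: real assume e: "0 < e"
    then have "s < s + e / (norm u + 1)" by (simp add: divide_pos_pos add_nonneg_pos)
    then obtain q where q: "q \<in> \<rat>" "s < q" "q < s + e / (norm u + 1)"
      using Rats_dense_in_real by blast
    have "norm u + 1 > 0" by (simp add: add_nonneg_pos)
    then have "(q - s) * (norm u + 1) < e" using q(3) by (simp add: field_simps)
    moreover have "(q - s) * norm u \<le> (q - s) * (norm u + 1)" using q by (intro mult_left_mono) auto
    moreover have "dist (P + q *\<^sub>R u) x = (q - s) * norm u"
      using q by (simp add: s dist_norm flip: scaleR_diff_left)
    ultimately show "\<exists>y\<in>S. dist y x < e" using assms[OF q(1)] q(2) s(2)
      by (intro bexI[of _ "P + q *\<^sub>R u"]) linarith+
  qed
qed

context padic_valued_field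
begin

lemma v_power: "x \<noteq> 0 \<Longrightarrow> v (x ^ m) = real m * v x"
  by (induction m) (auto simp: v_1 v_mult algebra_simps)

lemma v_p: "v (of_nat p) = 1"
  using prime_p v_of_nat[of p] by (simp add: prime_gt_0_nat not_prime_unit)

lemma v_of_int_unit:
  assumes "\<not> int p dvd m"
  shows "v (of_int m) = 0"
proof -
  have m: "m \<noteq> 0" using assms by auto
  have "\<not> p dvd nat \<bar>m\<bar>" using assms by (simp add: dvd_nat_abs_iff)
  then have "v (of_nat (nat \<bar>m\<bar>)) = 0"
    using m by (subst v_of_nat) (auto simp: not_dvd_imp_multiplicity_0)
  moreover have "of_int m = (of_nat (nat \<bar>m\<bar>) :: 'k) \<or> of_int m = - (of_nat (nat \<bar>m\<bar>) :: 'k)"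
    by (cases "m \<ge> 0") auto
  ultimately show ?thesis using v_minus[of "of_nat (nat \<bar>m\<bar>)"] m by auto
qed

lemma v_add_unit:
  assumes "\<not> int p dvd m" "y = 0 \<or> v y > 0"
  shows "y + of_int m \<noteq> 0" "v (y + of_int m) = 0"
proof -
  have m: "of_int m \<noteq> (0::'k)" "v (of_int m) = 0" using assms v_of_int_unit by auto
  show "y + of_int m \<noteq> 0" "v (y + of_int m) = 0"
    using v_add_eq[of "of_int m" y] m assms(2) by (cases "y = 0"; auto simp: add.commute)+
qed

end

lemma (in padic_complex_field) ex_v_eq_rat:
  assumes "q \<in> \<rat>" "0 < q"
  obtains x where "x \<noteq> 0" "v x = q"
proof -
  obtain i m where im: "m \<noteq> 0" "\<bar>q\<bar> = real i / real m"
    using Rats_abs_nat_div_natE[OF assms(1)] by metis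
  define P :: "'a poly" where "P = monom 1 m + [:- of_nat (p ^ i):]"
  have rat: "x \<in> Qp" if "x \<in> \<rat>" for x
    unfolding Qp_def using that closure_of_subset[of \<rat> mtopology] by auto
  have "x \<in> Qp_bar" if "x \<in> \<rat>" for x :: 'a
  proof -
    have "set (coeffs [:- x, 1:]) \<subseteq> Qp" using that rat by auto
    then show ?thesis unfolding Qp_bar_def by (intro CollectI exI[of _ "[:- x, 1:]"]) auto
  qed
  moreover have "coeff P j \<in> \<rat>" for j
    by (cases j) (auto simp: P_def coeff_pCons intro!: Rats_add)
  ultimately have "set (coeffs P) \<subseteq> Qp_bar" by (auto simp: coeffs_def)
  moreover have "degree P = m"
    unfolding P_def using im(1) by (subst degree_add_eq_left) (auto simp: degree_monom_eq)
  ultimately obtain x where "poly P x = 0" using Qp_bar_alg_closed im(1) by blast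
  then have x: "x ^ m = of_nat (p ^ i)" by (simp add: P_def poly_monom)
  have p0: "of_nat p \<noteq> (0::'a)" using prime_p prime_gt_0_nat by auto
  have "x \<noteq> 0" using x p0 im(1) by (auto simp: power_0_left)
  moreover have "real m * v x = real i"
    using v_power[OF \<open>x \<noteq> 0\<close>, of m] v_power[OF p0, of i] x v_p by simp
  then have "v x = real i / real m" using im(1) by (simp add: field_simps)
  then have "v x = q" using im(2) assms(2) by simp
  ultimately show ?thesis by (rule that)
qed

definition gale :: "nat \<Rightarrow> (nat \<Rightarrow> int \<times> int) \<Rightarrow> nat \<Rightarrow> int vec" where
  "gale n r j = vec n (\<lambda>i. if j = n + 1 then - fst (r i) else if j = n + 2 then - snd (r i)
     else if i = j then 1 else 0)"

lemma A_hat_mult_vec: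
  fixes x :: "rat vec"
  assumes "x \<in> carrier_vec (n + 3)"
  shows "(map_mat rat_of_int (A_hat n a) *\<^sub>v x) $ 0 = (\<Sum>j<n + 3. x $ j)"
    and "i < n \<Longrightarrow> (map_mat rat_of_int (A_hat n a) *\<^sub>v x) $ Suc i = (\<Sum>j<n + 3. of_int (a j $ i) * x $ j)"
  using assms by (auto simp: A_hat_def scalar_prod_def lessThan_atLeast0 intro!: sum.cong)

lemma A_hat_gale_mult_vec:
  fixes x :: "rat vec"
  assumes "x \<in> carrier_vec (n + 3)" "i < n"
  shows "(map_mat rat_of_int (A_hat n (gale n r)) *\<^sub>v x) $ Suc i =
    x $ i - of_int (fst (r i)) * x $ (n + 1) - of_int (snd (r i)) * x $ (n + 2)"
proof -
  have "(\<Sum>j<n. rat_of_int (gale n r j $ i) * x $ j) = (\<Sum>j<n. if i = j then x $ j else 0)"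
    using assms by (intro sum.cong) (auto simp: gale_def)
  also have "\<dots> = x $ i" using assms by simp
  finally show ?thesis unfolding A_hat_mult_vec(2)[OF assms]
    using assms(2) by (simp add: numeral_3_eq_3 gale_def)
qed

lemma kernel_A_hat_gale:
  fixes x :: "rat vec"
  assumes r: "r (n + 1) = (1, 0)" "r (n + 2) = (0, 1)"
    and sum: "(\<Sum>i<n + 3. fst (r i)) = 0" "(\<Sum>i<n + 3. snd (r i)) = 0"
    and x: "x \<in> carrier_vec (n + 3)"
  shows "map_mat rat_of_int (A_hat n (gale n r)) *\<^sub>v x = 0\<^sub>v (n + 1) \<longleftrightarrow>
    (\<forall>i<n + 3. x $ i = of_int (fst (r i)) * x $ (n + 1) + of_int (snd (r i)) * x $ (n + 2))"
    (is "?A *\<^sub>v x = _ \<longleftrightarrow> (\<forall>i<n + 3. ?R i)")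
proof -
  define f where "f i = rat_of_int (fst (r i)) * x $ (n + 1) + of_int (snd (r i)) * x $ (n + 2)" for i
  have "(\<Sum>i<n + 3. f i) = of_int (\<Sum>i<n + 3. fst (r i)) * x $ (n + 1) + of_int (\<Sum>i<n + 3. snd (r i)) * x $ (n + 2)"
    unfolding f_def sum.distrib of_int_sum sum_distrib_right ..
  then have f0: "(\<Sum>i<n + 3. f i) = 0" by (simp only: sum)
  have last: "f (n + 1) = x $ (n + 1)" "f (n + 2) = x $ (n + 2)" using r by (simp_all add: f_def)
  have 0: "(?A *\<^sub>v x) $ 0 = (\<Sum>i<n. x $ i - f i) + (x $ n - f n)"
  proof -
    have "(?A *\<^sub>v x) $ 0 = (\<Sum>i<n + 3. x $ i - f i)"
      unfolding A_hat_mult_vec(1)[OF x] sum_subtractf f0 by simp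
    also have "\<dots> = (\<Sum>i<n. x $ i - f i) + (x $ n - f n)"
      using last by (simp add: numeral_3_eq_3)
    finally show ?thesis .
  qed
  have S: "(?A *\<^sub>v x) $ Suc i = x $ i - f i" if "i < n" for i
    using A_hat_gale_mult_vec[OF x that] by (simp add: f_def)
  have "?A *\<^sub>v x = 0\<^sub>v (n + 1) \<longleftrightarrow> (\<forall>i<n + 1. (?A *\<^sub>v x) $ i = 0)"
    by (auto simp: vec_eq_iff A_hat_def)
  also have "\<dots> \<longleftrightarrow> (?A *\<^sub>v x) $ 0 = 0 \<and> (\<forall>i<n. (?A *\<^sub>v x) $ Suc i = 0)"
    by (auto simp: less_Suc_eq_0_disj)
  also have "\<dots> \<longleftrightarrow> x $ n - f n = 0 \<and> (\<forall>i<n. x $ i - f i = 0)"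
    using S 0 by auto
  also have "\<dots> \<longleftrightarrow> (\<forall>i<n + 3. x $ i = f i)"
    using last by (auto simp: numeral_3_eq_3 less_Suc_eq)
  finally show ?thesis by (simp add: f_def)
qed

lemma rank_eq_if_surj:
  fixes A :: "'a::field mat"
  assumes A: "A \<in> carrier_mat n m"
    and surj: "\<And>y. y \<in> carrier_vec n \<Longrightarrow> \<exists>x\<in>carrier_vec m. A *\<^sub>v x = y"
  shows "vec_space.rank n A = n"
proof -
  interpret vec_space "TYPE('a)" n .
  have "col_space A = {y \<in> carrier_vec (dim_row A). \<exists>x\<in>carrier_vec (dim_col A). A *\<^sub>v x = y}"
    by (rule col_space_eq[OF A])
  then have "span (set (cols A)) = carrier_vec n"
    using A surj by (auto simp: col_space_def)
  moreover have "vs (carrier_vec n) = V" by (simp add: module_vec_def)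
  ultimately have "rank A = dim" by (simp only: rank_def)
  then show ?thesis using dim_is_n by simp
qed

lemma is_support_gale:
  assumes n: "n \<ge> 1" and r0: "fst (r 0) > 0" "snd (r 0) > 0" "fst (r 0) \<noteq> snd (r 0)"
  shows "is_support n (gale n r)"
  unfolding is_support_def
proof (intro conjI)
  show "\<forall>i<n + 3. gale n r i \<in> carrier_vec n" by (simp add: gale_def)
  show "inj_on (gale n r) {..<n + 3}"
  proof (rule linorder_inj_onI')
    fix i j assume "i \<in> {..<n + 3}" "j \<in> {..<n + 3}" "i < j"
    have e0: "gale n r j $ 0 = (if j = n + 1 then - fst (r 0) else if j = n + 2 then - snd (r 0)
      else if 0 = j then 1 else 0)" for j using n by (simp add: gale_def)
    show "gale n r i \<noteq> gale n r j"
    proof (cases "j \<le> n")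
      case True
      then have "gale n r i $ i = 1" "gale n r j $ i = 0" using \<open>i < j\<close> by (auto simp: gale_def)
      then show ?thesis by auto
    next
      case False
      then have "gale n r i $ 0 \<noteq> gale n r j $ 0"
        unfolding e0 using r0 \<open>i < j\<close> \<open>j \<in> _\<close> by (auto split: if_splits)
      then show ?thesis by metis
    qed
  qed
  show "vec_space.rank (n + 1) (map_mat rat_of_int (A_hat n (gale n r))) = n + 1"
  proof (rule rank_eq_if_surj)
    show "map_mat rat_of_int (A_hat n (gale n r)) \<in> carrier_mat (n + 1) (n + 3)"
      by (simp add: A_hat_def)
    fix y :: "rat vec" assume y: "y \<in> carrier_vec (n + 1)"
    define x where "x = vec (n + 3) (\<lambda>i. if i < n then y $ Suc i
      else if i = n then y $ 0 - (\<Sum>j<n. y $ Suc j) else 0)"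
    have x: "x \<in> carrier_vec (n + 3)" by (simp add: x_def)
    have "(\<Sum>j<n. x $ j) = (\<Sum>j<n. y $ Suc j)" by (intro sum.cong) (auto simp: x_def)
    then have 0: "(map_mat rat_of_int (A_hat n (gale n r)) *\<^sub>v x) $ 0 = y $ 0"
      unfolding A_hat_mult_vec(1)[OF x] by (simp add: numeral_3_eq_3) (simp add: x_def)
    have "(map_mat rat_of_int (A_hat n (gale n r)) *\<^sub>v x) $ Suc i = y $ Suc i" if "i < n" for i
      unfolding A_hat_gale_mult_vec[OF x that] using that by (simp add: x_def)
    then have "map_mat rat_of_int (A_hat n (gale n r)) *\<^sub>v x = y"
      using 0 y by (auto simp: vec_eq_iff A_hat_def less_Suc_eq_0_disj)
    then show "\<exists>x\<in>carrier_vec (n + 3). map_mat rat_of_int (A_hat n (gale n r)) *\<^sub>v x = y"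
      using x by blast
  qed
qed

lemma null_space_basis_gale:
  assumes r: "r (n + 1) = (1, 0)" "r (n + 2) = (0, 1)"
    and sum: "(\<Sum>i<n + 3. fst (r i)) = 0" "(\<Sum>i<n + 3. snd (r i)) = 0"
    and nb: "null_space_basis n (gale n r) B"
  shows "i < n + 3 \<Longrightarrow> j < 2 \<Longrightarrow>
      B $$ (i, j) = fst (r i) * B $$ (n + 1, j) + snd (r i) * B $$ (n + 2, j)"
    and "B $$ (n + 1, 0) * B $$ (n + 2, 1) \<noteq> B $$ (n + 1, 1) * B $$ (n + 2, 0)"
proof -
  let ?A = "map_mat rat_of_int (A_hat n (gale n r))" and ?B = "map_mat rat_of_int B"
  have A: "?A \<in> carrier_mat (n + 1) (n + 3)" by (simp add: A_hat_def)
  interpret kernel "n + 1" "n + 3" ?A by unfold_locales (rule A)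
  have B: "B \<in> carrier_mat (n + 3) 2" and basis: "Ker.basis (set (cols ?B))"
    using nb unfolding null_space_basis_def by auto
  have sub: "set (cols ?B) \<subseteq> mat_kernel ?A" and gen: "span (set (cols ?B)) = mat_kernel ?A"
    using basis unfolding Ker.basis_def by auto
  show rel: "B $$ (i, j) = fst (r i) * B $$ (n + 1, j) + snd (r i) * B $$ (n + 2, j)"
    if "i < n + 3" "j < 2" for i j
  proof -
    have "col ?B j \<in> mat_kernel ?A" using sub B that by (auto simp: cols_def)
    then have "?A *\<^sub>v col ?B j = 0\<^sub>v (n + 1)" "col ?B j \<in> carrier_vec (n + 3)"
      using mat_kernelD[OF A] by blast+
    then have "col ?B j $ i = of_int (fst (r i)) * col ?B j $ (n + 1)
        + of_int (snd (r i)) * col ?B j $ (n + 2)"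
      using kernel_A_hat_gale[where x = "col ?B j" and r = r, OF r sum] \<open>i < n + 3\<close> by blast
    moreover have "col ?B j $ l = of_int (B $$ (l, j))" if "l < n + 3" for l
      using B that \<open>j < 2\<close> by simp
    from this[OF \<open>i < n + 3\<close>] this[of "n + 1"] this[of "n + 2"]
    have "col ?B j $ i = of_int (B $$ (i, j))" "col ?B j $ (n + 1) = of_int (B $$ (n + 1, j))"
      "col ?B j $ (n + 2) = of_int (B $$ (n + 2, j))" by simp_all
    ultimately have "rat_of_int (B $$ (i, j)) = of_int (fst (r i)) * of_int (B $$ (n + 1, j)) +
        of_int (snd (r i)) * of_int (B $$ (n + 2, j))"
      by (simp only:)
    then have "rat_of_int (B $$ (i, j)) =
        of_int (fst (r i) * B $$ (n + 1, j) + snd (r i) * B $$ (n + 2, j))" by simp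
    then show ?thesis by (simp only: of_int_eq_iff)
  qed
  show "B $$ (n + 1, 0) * B $$ (n + 2, 1) \<noteq> B $$ (n + 1, 1) * B $$ (n + 2, 0)"
  proof
    assume det: "B $$ (n + 1, 0) * B $$ (n + 2, 1) = B $$ (n + 1, 1) * B $$ (n + 2, 0)"
    obtain s t :: int where st: "s \<noteq> 0 \<or> t \<noteq> 0"
      "\<And>j. j < 2 \<Longrightarrow> s * B $$ (n + 1, j) + t * B $$ (n + 2, j) = 0"
    proof (cases "B $$ (n + 1, 0) = 0 \<and> B $$ (n + 2, 0) = 0")
      case True
      show ?thesis
      proof (cases "B $$ (n + 1, 1) = 0 \<and> B $$ (n + 2, 1) = 0")
        case t2: True
        show ?thesis
          by (rule that[of 1 0]) (use True t2 in \<open>auto dest!: less_2_cases\<close>)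
      next
        case False
        show ?thesis
          by (rule that[of "B $$ (n + 2, 1)" "- B $$ (n + 1, 1)"])
            (use True False in \<open>auto dest!: less_2_cases\<close>)
      qed
    next
      case False
      show ?thesis
        by (rule that[of "B $$ (n + 2, 0)" "- B $$ (n + 1, 0)"])
          (use False det in \<open>auto dest!: less_2_cases simp: algebra_simps\<close>)
    qed
    have zero: "of_int s * y $ (n + 1) + of_int t * y $ (n + 2) = 0" if ker: "y \<in> mat_kernel ?A" for y :: "rat vec"
    proof -
      have "y \<in> span (set (cols ?B))" using ker by (simp only: gen)
      then obtain c U where U: "finite U" "U \<subseteq> set (cols ?B)" "y = lincomb c U"
        unfolding Ker.span_def by blast
      have n1: "n + 1 < n + 3" and n2: "n + 2 < n + 3" by simp_all
      have Uk: "U \<subseteq> mat_kernel ?A" using U sub by auto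
      have "of_int s * y $ (n + 1) + of_int t * y $ (n + 2) =
        (\<Sum>x\<in>U. c x * (of_int s * x $ (n + 1) + of_int t * x $ (n + 2)))"
        unfolding U(3) lincomb_index[OF n1 Uk] lincomb_index[OF n2 Uk]
        by (simp only: sum_distrib_left distrib_left sum.distrib mult.left_commute)
      also have "\<dots> = 0"
      proof (intro sum.neutral ballI)
        fix x assume "x \<in> U"
        then obtain j where j: "j < 2" "x = col ?B j" using U B by (auto simp: cols_def)
        then have "of_int s * x $ (n + 1) + of_int t * x $ (n + 2)
          = rat_of_int (s * B $$ (n + 1, j) + t * B $$ (n + 2, j))" using B by simp
        then show "c x * (of_int s * x $ (n + 1) + of_int t * x $ (n + 2)) = 0"
          by (simp only: st(2)[OF j(1)] of_int_0 mult_zero_right)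
      qed
      finally show ?thesis .
    qed
    have mem: "vec (n + 3) (\<lambda>i. of_int (f (r i))) \<in> mat_kernel ?A" if f: "f = fst \<or> f = snd" for f
    proof (rule mat_kernelI[OF A])
      show "?A *\<^sub>v vec (n + 3) (\<lambda>i. of_int (f (r i))) = 0\<^sub>v (n + 1)"
        by (subst kernel_A_hat_gale[where r = r, OF r sum]) (use f r in auto)
    qed simp
    from zero[OF mem[of fst]] zero[OF mem[of snd]] have "s = 0" "t = 0" using r by auto
    then show False using st by blast
  qed
qed

section \<open>Two crossing pencils\<close>

definition lin2 :: "(nat \<Rightarrow> int) \<Rightarrow> (nat \<Rightarrow> int) \<Rightarrow> real \<times> real \<Rightarrow> real \<times> real" where
  "lin2 M N z = (of_int (M 0) * fst z + of_int (N 0) * snd z, of_int (M 1) * fst z + of_int (N 1) * snd z)"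

lemma lin2_add: "lin2 M N (x + y) = lin2 M N x + lin2 M N y"
  and lin2_scaleR: "lin2 M N (s *\<^sub>R x) = s *\<^sub>R lin2 M N x"
  by (simp_all add: lin2_def algebra_simps)

lemma cross2_lin2:
  "cross2 (lin2 M N x) (lin2 M N y) = of_int (M 0 * N 1 - M 1 * N 0) * cross2 x y"
  by (simp add: cross2_def lin2_def algebra_simps)

lemma inj_lin2:
  assumes "M 0 * N 1 \<noteq> M 1 * N 0"
  shows "inj (lin2 M N)"
proof (rule injI)
  fix x y assume eq: "lin2 M N x = lin2 M N y"
  have "real_of_int (M 0 * N 1 - M 1 * N 0) * cross2 (x - y) u = 0" for u
    using cross2_lin2[of M N "x - y" u] eq lin2_add[of M N "x - y" y] by (simp add: cross2_def)
  moreover have "real_of_int (M 0 * N 1 - M 1 * N 0) \<noteq> 0"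
    using assms by (simp only: of_int_eq_0_iff)
  ultimately have "cross2 (x - y) u = 0" for u by simp
  from this[of "(1, 0)"] this[of "(0, 1)"] show "x = y"
    by (simp add: cross2_def prod_eq_iff)
qed

lemma cone_at_lin2: "cone_at (lin2 M N P) (lin2 M N u) (lin2 M N w) = lin2 M N ` cone_at P u w"
  unfolding cone_at_def by (force simp: lin2_add lin2_scaleR)

definition real_pair :: "int \<times> int \<Rightarrow> real \<times> real" where
  "real_pair z = (of_int (fst z), of_int (snd z))"

text \<open>A point of the parameter line is given by homogeneous coordinates \<open>(X, Y)\<close>; rescaling
  them does not move the amoeba point because the rows \<open>r i\<close> sum to zero.\<close>

lemma (in padic_valued_field) reduced_amoeba_homogeneous:
  fixes X Y :: 'k
  assumes B: "\<And>i j. i < n + 3 \<Longrightarrow> j < 2 \<Longrightarrow> B $$ (i, j) = fst (r i) * M j + snd (r i) * N j"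
    and det: "M 0 * N 1 \<noteq> M 1 * N 0"
    and sum: "(\<Sum>i<n + 3. fst (r i)) = 0" "(\<Sum>i<n + 3. snd (r i)) = 0"
    and nz: "\<And>i. i < n + 3 \<Longrightarrow> of_int (fst (r i)) * X + of_int (snd (r i)) * Y \<noteq> 0"
    and e: "of_int (M 0) * Y - of_int (N 0) * X \<noteq> 0"
  shows "lin2 M N (\<Sum>i<n + 3. v (of_int (fst (r i)) * X + of_int (snd (r i)) * Y) *\<^sub>R real_pair (r i))
     \<in> reduced_amoeba n B v"
proof -
  let ?e = "of_int (M 0) * Y - of_int (N 0) * X"
  let ?f = "\<lambda>i. of_int (fst (r i)) * X + of_int (snd (r i)) * Y"
  define d where "d = (of_int (M 0 * N 1 - M 1 * N 0) :: 'k)"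
  define z where "z = (of_int (N 1) * X - of_int (M 1) * Y) / ?e"
  have d: "d \<noteq> 0" unfolding d_def using det by (simp only: of_int_eq_0_iff)
  have ze: "z * ?e = of_int (N 1) * X - of_int (M 1) * Y" using e by (simp add: z_def)
  have lf: "lin_form B i z = ?f i * (d / ?e)" if "i < n + 3" for i
  proof -
    have "lin_form B i z * ?e = (of_int (fst (r i)) * of_int (M 0) + of_int (snd (r i)) * of_int (N 0)) * (z * ?e)
        + (of_int (fst (r i)) * of_int (M 1) + of_int (snd (r i)) * of_int (N 1)) * ?e"
      using B[OF that] by (simp add: lin_form_def algebra_simps)
    also have "\<dots> = ?f i * d" unfolding ze d_def by (simp add: algebra_simps)
    finally show ?thesis using e by (simp add: field_simps)
  qed
  define c where "c = v (d / ?e)"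
  have vl: "v (lin_form B i z) = v (?f i) + c" if "i < n + 3" for i
    unfolding lf[OF that] c_def using nz[OF that] d e by (intro v_mult) auto
  have S: "(\<Sum>i<n + 3. real_of_int (B $$ (i, j)) * v (lin_form B i z)) =
      of_int (M j) * (\<Sum>i<n + 3. v (?f i) * of_int (fst (r i))) +
      of_int (N j) * (\<Sum>i<n + 3. v (?f i) * of_int (snd (r i)))" if j: "j < 2" for j
  proof -
    have "(\<Sum>i<n + 3. real_of_int (B $$ (i, j)) * v (lin_form B i z)) =
      (\<Sum>i<n + 3. of_int (M j) * (v (?f i) * of_int (fst (r i))) + of_int (N j) * (v (?f i) * of_int (snd (r i)))
        + c * (of_int (M j) * of_int (fst (r i)) + of_int (N j) * of_int (snd (r i))))"
      using B j by (intro sum.cong) (auto simp: vl algebra_simps)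
    also have "\<dots> = of_int (M j) * (\<Sum>i<n + 3. v (?f i) * of_int (fst (r i))) +
      of_int (N j) * (\<Sum>i<n + 3. v (?f i) * of_int (snd (r i)))
      + c * (of_int (M j) * of_int (\<Sum>i<n + 3. fst (r i)) + of_int (N j) * of_int (\<Sum>i<n + 3. snd (r i)))"
      unfolding sum.distrib sum_distrib_left[symmetric] of_int_sum[symmetric] ..
    finally show ?thesis unfolding sum by simp
  qed
  have "(0::nat) < 2" "(1::nat) < 2" by simp_all
  note S0 = S[OF this(1)] and S1 = S[OF this(2)]
  have "lin2 M N (\<Sum>i<n + 3. v (?f i) *\<^sub>R real_pair (r i)) =
    (\<Sum>i<n + 3. of_int (B $$ (i, 0)) * v (lin_form B i z), \<Sum>i<n + 3. of_int (B $$ (i, 1)) * v (lin_form B i z))"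
    unfolding S0 S1 lin2_def real_pair_def
    by (simp add: fst_sum snd_sum)
  moreover have "lin_form B i z \<noteq> 0" if "i < n + 3" for i
    unfolding lf[OF that] using nz[OF that] d e by simp
  ultimately show ?thesis unfolding reduced_amoeba_def by blast
qed

text \<open>The rows \<open>(p, a)\<close> and \<open>(b, p)\<close> with \<open>1 \<le> a, b \<le> k\<close> give zeros \<open>-a/p\<close> and \<open>-p/b\<close>, which form
  two groups of points at mutual distances \<open>p\<close> and \<open>1/p\<close>. Hence their rays start from two common
  points only. The zeros of the last four rows have other valuations, so they do not interfere; the
  rows are chosen so that the two pencils lie in position to cross each other.\<close>

definition pencil_q :: "nat \<Rightarrow> nat \<Rightarrow> int" where
  "pencil_q p k = int p ^ 2 - int k * int p - 1 - (\<Sum>j<k. int (Suc j))"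

definition pencils :: "nat \<Rightarrow> nat \<Rightarrow> nat \<Rightarrow> int \<times> int" where
  "pencils p k j = (if j < k then (int p, int (Suc j))
     else if j < 2 * k then (int (Suc (j - k)), int p)
     else if j = 2 * k then (- (int p ^ 2), pencil_q p k)
     else if j = 2 * k + 1 then (pencil_q p k, - (int p ^ 2))
     else if j = 2 * k + 2 then (1, 0) else (0, 1))"

lemma sum_pencils:
  fixes f :: "nat \<Rightarrow> 'b::comm_monoid_add"
  shows "(\<Sum>j<2 * k + 1 + 3. f j) = (\<Sum>j<k. f j) + (\<Sum>j<k. f (k + j)) + f (2 * k) + f (2 * k + 1)
    + f (2 * k + 2) + f (2 * k + 3)"
proof -
  have "(\<Sum>j<k + m. f j) = (\<Sum>j<k. f j) + (\<Sum>j<m. f (k + j))" for m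
    by (induction m) (simp_all add: add.assoc)
  from this[of k] show ?thesis by (simp add: mult_2 numeral_3_eq_3 numeral_2_eq_2 add.assoc)
qed

lemma pencils_sum_0:
  "(\<Sum>j<2 * k + 1 + 3. fst (pencils p k j)) = 0" "(\<Sum>j<2 * k + 1 + 3. snd (pencils p k j)) = 0"
  unfolding sum_pencils by (simp_all add: pencils_def pencil_q_def)

lemma sum_Suc_le: "(\<Sum>j<k. int (Suc j)) \<le> int k ^ 2"
  by (induction k) (auto simp: power2_eq_square algebra_simps)

lemma pencil_q_unit:
  assumes "(k + 2) ^ 2 < p"
  shows "\<not> int p dvd pencil_q p k"
proof
  let ?S = "\<Sum>j<k. int (Suc j)"
  assume "int p dvd pencil_q p k"
  moreover have "int p dvd int p * (int p - int k)" by simp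
  ultimately have "int p dvd int p * (int p - int k) - pencil_q p k" by (rule dvd_diff[rotated])
  moreover have "int p * (int p - int k) - pencil_q p k = 1 + ?S"
    by (simp add: pencil_q_def power2_eq_square algebra_simps)
  moreover have "0 < 1 + ?S" using sum_nonneg[of "{..<k}" "\<lambda>j. int (Suc j)"] by simp
  ultimately have "int p \<le> 1 + ?S" by (metis zdvd_imp_le)
  moreover have "int ((k + 2) ^ 2) < int p" using assms by (simp only: of_nat_less_iff)
  then have "int k ^ 2 + 4 * int k + 4 < int p" by (simp add: power2_eq_square algebra_simps)
  ultimately show False using sum_Suc_le[of k] by linarith
qed

context padic_valued_field
begin

lemma v_pencil_entries:
  assumes p: "(k + 2) ^ 2 < p" and x: "x \<noteq> 0" "v x > 0" and b: "1 \<le> b" "b \<le> k"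
  defines "h \<equiv> x - of_nat b" and "P \<equiv> of_nat p"
  shows "h \<noteq> 0" "v h = 0" "P \<noteq> 0" "v P = 1"
    and "1 \<le> c \<Longrightarrow> c \<le> k \<Longrightarrow> P * h + of_nat c * P \<noteq> 0"
    and "1 \<le> c \<Longrightarrow> c \<le> k \<Longrightarrow> v (P * h + of_nat c * P) = 1 + (if c = b then v x else 0)"
    and "1 \<le> c \<Longrightarrow> c \<le> k \<Longrightarrow> of_nat c * h + P * P \<noteq> 0 \<and> v (of_nat c * h + P * P) = 0"
    and "- (P ^ 2) * h + of_int (pencil_q p k) * P \<noteq> 0 \<and> v (- (P ^ 2) * h + of_int (pencil_q p k) * P) = 1"
    and "of_int (pencil_q p k) * h - P ^ 2 * P \<noteq> 0 \<and> v (of_int (pencil_q p k) * h - P ^ 2 * P) = 0"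
proof -
  have "k < (k + 2) ^ 2" by (simp add: power2_eq_square)
  then have kp: "k < p" using p by linarith
  have unit: "\<not> int p dvd m" if "m \<noteq> 0" "\<bar>m\<bar> \<le> int k" for m
    using zdvd_imp_le[of "int p" "\<bar>m\<bar>"] that kp by auto
  have h: "h = x + of_int (- int b)" by (simp add: h_def)
  have "\<not> int p dvd - int b" using b by (intro unit) auto
  then show h0: "h \<noteq> 0" and vh: "v h = 0" unfolding h using v_add_unit x by blast+
  show P0: "P \<noteq> 0" using prime_p prime_gt_0_nat by (auto simp: P_def)
  show vP: "v P = 1" using v_p by (simp add: P_def)
  have vPm: "v (P ^ m) = real m" for m using v_power[OF P0, of m] vP by simp
  { assume c: "1 \<le> c" "c \<le> k"
    have e: "P * h + of_nat c * P = P * (x + of_int (int c - int b))"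
      by (simp add: h_def algebra_simps)
    have "x + of_int (int c - int b) \<noteq> 0 \<and> v (x + of_int (int c - int b)) = (if c = b then v x else 0)"
    proof (cases "c = b")
      case False
      then have "\<not> int p dvd int c - int b" using b c by (intro unit) auto
      then show ?thesis using v_add_unit[of "int c - int b" x] x False by auto
    qed (use x in auto)
    then show "P * h + of_nat c * P \<noteq> 0" "v (P * h + of_nat c * P) = 1 + (if c = b then v x else 0)"
      unfolding e using P0 vP by (simp_all add: v_mult)
    have "\<not> int p dvd int c" using c by (intro unit) auto
    then have "v (of_nat c) = 0" using v_of_int_unit[of "int c"] by simp
    then have ch: "of_nat c * h \<noteq> 0" "v (of_nat c * h) = 0" using h0 vh c by (auto simp: v_mult)
    show "of_nat c * h + P * P \<noteq> 0 \<and> v (of_nat c * h + P * P) = 0"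
      using v_add_eq[of "of_nat c * h" "P * P"] ch P0 vP by (simp add: v_mult) }
  note q = pencil_q_unit[OF p]
  have q0: "of_int (pencil_q p k) \<noteq> (0::'k)" "v (of_int (pencil_q p k)) = 0"
    using q v_of_int_unit by auto
  have Ph: "v (- (P * h)) = 1" using v_minus[of "P * h"] P0 h0 vP vh by (simp add: v_mult)
  have e: "- (P ^ 2) * h + of_int (pencil_q p k) * P = P * (- (P * h) + of_int (pencil_q p k))"
    by (simp add: power2_eq_square algebra_simps)
  show "- (P ^ 2) * h + of_int (pencil_q p k) * P \<noteq> 0 \<and> v (- (P ^ 2) * h + of_int (pencil_q p k) * P) = 1"
    unfolding e using v_add_unit[OF q, of "- (P * h)"] Ph P0 vP by (simp add: v_mult)
  have "v (- (P ^ 3)) = 3" using v_minus[of "P ^ 3"] vPm[of 3] P0 by simp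
  moreover have "of_int (pencil_q p k) * h - P ^ 2 * P = of_int (pencil_q p k) * h + - (P ^ 3)"
    by (simp add: power3_eq_cube power2_eq_square)
  ultimately show "of_int (pencil_q p k) * h - P ^ 2 * P \<noteq> 0 \<and> v (of_int (pencil_q p k) * h - P ^ 2 * P) = 0"
    using v_add_eq[of "of_int (pencil_q p k) * h" "- (P ^ 3)"] q0 h0 vh P0 by (simp add: v_mult)
qed

lemma pencil_sums:
  assumes p: "(k + 2) ^ 2 < p" and x: "x \<noteq> 0" "v x > 0" and i: "i < k"
  defines "h \<equiv> x - of_nat (Suc i)" and "D \<equiv> real p ^ 2 - real k * real p"
  defines "f \<equiv> \<lambda>X Y j. of_int (fst (pencils p k j)) * X + of_int (snd (pencils p k j)) * (Y :: 'k)"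
  shows "j < 2 * k + 1 + 3 \<Longrightarrow> f h (of_nat p) j \<noteq> 0 \<and> f (of_nat p) h j \<noteq> 0"
    and "(\<Sum>j<2 * k + 1 + 3. v (f h (of_nat p) j) *\<^sub>R real_pair (pencils p k j)) =
      (- D, D) + v x *\<^sub>R (real p, real (Suc i))"
    and "(\<Sum>j<2 * k + 1 + 3. v (f (of_nat p) h j) *\<^sub>R real_pair (pencils p k j)) =
      (D, - D) + v x *\<^sub>R (real (Suc i), real p)"
proof -
  have b: "1 \<le> Suc i" "Suc i \<le> k" using i by auto
  note * = v_pencil_entries[OF p x b, folded h_def]
  let ?P = "of_nat p :: 'k"
  let ?q = "pencil_q p k"
  have f1: "f h ?P j = ?P * h + of_nat (Suc j) * ?P"
    and f2: "f h ?P (k + j) = of_nat (Suc j) * h + ?P * ?P"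
    and g1: "f ?P h j = of_nat (Suc j) * h + ?P * ?P"
    and g2: "f ?P h (k + j) = ?P * h + of_nat (Suc j) * ?P" if "j < k" for j
    using that by (simp_all add: f_def pencils_def)
  have f3: "f h ?P (2 * k) = - (?P ^ 2) * h + of_int ?q * ?P"
    "f h ?P (2 * k + 1) = of_int ?q * h - ?P ^ 2 * ?P"
    "f h ?P (2 * k + 2) = h" "f h ?P (2 * k + 3) = ?P"
    and g3: "f ?P h (2 * k) = of_int ?q * h - ?P ^ 2 * ?P"
    "f ?P h (2 * k + 1) = - (?P ^ 2) * h + of_int ?q * ?P"
    "f ?P h (2 * k + 2) = ?P" "f ?P h (2 * k + 3) = h"
    by (simp_all add: f_def pencils_def)
  show "f h ?P j \<noteq> 0 \<and> f ?P h j \<noteq> 0" if j: "j < 2 * k + 1 + 3"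
  proof -
    consider "j < k" | l where "l < k" "j = k + l" | "j = 2 * k" | "j = 2 * k + 1" | "j = 2 * k + 2"
      | "j = 2 * k + 3"
    proof -
      have "j < k \<or> (k \<le> j \<and> j < 2 * k) \<or> j = 2 * k \<or> j = 2 * k + 1 \<or> j = 2 * k + 2 \<or> j = 2 * k + 3"
        using j by linarith
      moreover have "j - k < k \<and> j = k + (j - k)" if "k \<le> j \<and> j < 2 * k" using that by auto
      ultimately show thesis using that by blast
    qed
    then show ?thesis
    proof cases
      case 1
      show ?thesis unfolding f1[OF 1] g1[OF 1] using *(5,7)[of "Suc j"] 1 by simp
    next
      case 2
      show ?thesis unfolding 2(2) f2[OF 2(1)] g2[OF 2(1)] using *(5,7)[of "Suc l"] 2(1) by simp
    qed (simp_all only: f3 g3 * simp_thms)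
  qed
  have A: "(\<Sum>j<k. v (?P * h + of_nat (Suc j) * ?P) *\<^sub>R g j) = (\<Sum>j<k. g j) + v x *\<^sub>R g i"
    for g :: "nat \<Rightarrow> real \<times> real"
  proof -
    have "(\<Sum>j<k. v (?P * h + of_nat (Suc j) * ?P) *\<^sub>R g j) =
        (\<Sum>j<k. g j + (if j = i then v x *\<^sub>R g j else 0))"
    proof (intro sum.cong refl)
      fix j assume "j \<in> {..<k}"
      then have "v (?P * h + of_nat (Suc j) * ?P) = 1 + (if Suc j = Suc i then v x else 0)"
        by (intro *(6)) auto
      then show "v (?P * h + of_nat (Suc j) * ?P) *\<^sub>R g j = g j + (if j = i then v x *\<^sub>R g j else 0)"
        by (simp add: scaleR_add_left)
    qed
    then show ?thesis using i by (simp add: sum.distrib)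
  qed
  have Z: "(\<Sum>j<k. v (of_nat (Suc j) * h + ?P * ?P) *\<^sub>R g j) = 0" for g :: "nat \<Rightarrow> real \<times> real"
  proof (intro sum.neutral ballI)
    fix j assume "j \<in> {..<k}"
    then show "v (of_nat (Suc j) * h + ?P * ?P) *\<^sub>R g j = 0" using *(7)[of "Suc j"] by simp
  qed
  have q: "real_of_int ?q = D - 1 - (\<Sum>j<k. real (Suc j))"
    by (simp add: pencil_q_def D_def)
  have "(\<Sum>j<2 * k + 1 + 3. v (f h ?P j) *\<^sub>R real_pair (pencils p k j)) =
      (\<Sum>j<k. real_pair (pencils p k j)) + v x *\<^sub>R real_pair (pencils p k i)
      + real_pair (pencils p k (2 * k)) + real_pair (pencils p k (2 * k + 3))"
    unfolding sum_pencils f3 using * A[of "\<lambda>j. real_pair (pencils p k j)"]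
      Z[of "\<lambda>j. real_pair (pencils p k (k + j))"]
    by (simp add: f1 f2 del: of_nat_Suc)
  also have "(\<Sum>j<k. real_pair (pencils p k j)) = (\<Sum>j<k. (real p, real (Suc j)))"
    by (intro sum.cong) (auto simp: real_pair_def pencils_def)
  finally show "(\<Sum>j<2 * k + 1 + 3. v (f h ?P j) *\<^sub>R real_pair (pencils p k j)) =
      (- D, D) + v x *\<^sub>R (real p, real (Suc i))"
    using i by (simp add: sum_prod real_pair_def pencils_def q D_def)
  have "(\<Sum>j<2 * k + 1 + 3. v (f ?P h j) *\<^sub>R real_pair (pencils p k j)) =
      (\<Sum>j<k. real_pair (pencils p k (k + j))) + v x *\<^sub>R real_pair (pencils p k (k + i))
      + real_pair (pencils p k (2 * k + 1)) + real_pair (pencils p k (2 * k + 2))"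
    unfolding sum_pencils g3 using * A[of "\<lambda>j. real_pair (pencils p k (k + j))"]
      Z[of "\<lambda>j. real_pair (pencils p k j)"]
    by (simp add: g1 g2 del: of_nat_Suc)
  also have "(\<Sum>j<k. real_pair (pencils p k (k + j))) = (\<Sum>j<k. (real (Suc j), real p))"
    by (intro sum.cong) (auto simp: real_pair_def pencils_def)
  finally show "(\<Sum>j<2 * k + 1 + 3. v (f ?P h j) *\<^sub>R real_pair (pencils p k j)) =
      (D, - D) + v x *\<^sub>R (real (Suc i), real p)"
    using i by (simp add: sum_prod real_pair_def pencils_def q D_def)
qed

end

lemma (in padic_complex_field) pencil_rays:
  assumes nb: "null_space_basis (2 * k + 1) (gale (2 * k + 1) (pencils p k)) B"
    and p: "(k + 2) ^ 2 < p" and i: "i < k"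
  defines "L \<equiv> lin2 (\<lambda>j. B $$ (2 * k + 2, j)) (\<lambda>j. B $$ (2 * k + 3, j))"
    and "D \<equiv> real p ^ 2 - real k * real p"
  shows "ray (L (- D, D)) (L (real p, real (Suc i))) \<subseteq> closure (reduced_amoeba (2 * k + 1) B v)"
    and "ray (L (D, - D)) (L (real (Suc i), real p)) \<subseteq> closure (reduced_amoeba (2 * k + 1) B v)"
proof -
  let ?n = "2 * k + 1" and ?r = "pencils p k"
  let ?M = "\<lambda>j. B $$ (2 * k + 2, j)" and ?N = "\<lambda>j. B $$ (2 * k + 3, j)"
  have idx: "?n + 1 = 2 * k + 2" "?n + 2 = 2 * k + 3" by simp_all
  have r: "?r (?n + 1) = (1, 0)" "?r (?n + 2) = (0, 1)" by (simp_all add: pencils_def)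
  note rows = null_space_basis_gale(1)[OF r pencils_sum_0 nb, unfolded idx]
  note det = null_space_basis_gale(2)[OF r pencils_sum_0 nb, unfolded idx]
  have MN: "of_int (?M 0) \<noteq> (0::'a) \<or> of_int (?N 0) \<noteq> (0::'a)" using det by auto
  have choose: "\<exists>y. y \<noteq> 0 \<and> v y = q \<and> a + b * y \<noteq> 0"
    if q: "q \<in> \<rat>" "0 < q" and ab: "a \<noteq> 0 \<or> b \<noteq> 0" for a b :: 'a and q :: real
  proof -
    obtain x where x: "x \<noteq> 0" "v x = q" using ex_v_eq_rat[OF q] by blast
    have "a + b * x \<noteq> 0 \<or> a + b * (- x) \<noteq> 0"
    proof (rule ccontr)
      assume "\<not> ?thesis"
      then have z: "a + b * x = 0" "a - b * x = 0" by auto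
      then have "2 * a = 0" by (metis add_diff_eq add_diff_cancel_left' diff_0_right diff_eq_eq mult_2)
      then have "a = 0" by simp
      then show False using z ab x by simp
    qed
    then show ?thesis using x v_minus[of x] by (metis neg_equal_0_iff_equal)
  qed
  have P0: "of_nat p \<noteq> (0::'a)" using prime_p prime_gt_0_nat by auto
  have ab1: "of_int (?M 0) * of_nat p + of_int (?N 0) * of_nat (Suc i) \<noteq> (0::'a) \<or> - of_int (?N 0) \<noteq> (0::'a)"
    and ab2: "- of_int (?M 0) * of_nat (Suc i) - of_int (?N 0) * of_nat p \<noteq> (0::'a) \<or> of_int (?M 0) \<noteq> (0::'a)"
    using MN P0 by auto
  note amoeba = reduced_amoeba_homogeneous[where n = ?n and r = ?r and M = ?M and N = ?N and B = B,
      OF rows det pencils_sum_0]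
  show "ray (L (- D, D)) (L (real p, real (Suc i))) \<subseteq> closure (reduced_amoeba ?n B v)"
  proof (rule ray_subset_closure)
    fix q :: real assume q: "q \<in> \<rat>" "0 < q"
    obtain y where y: "y \<noteq> 0" "v y = q"
      "of_int (?M 0) * of_nat p + of_int (?N 0) * of_nat (Suc i) + - of_int (?N 0) * y \<noteq> (0::'a)"
      using choose[OF q ab1] by blast
    have vy: "v y > 0" using y q by simp
    note ps = pencil_sums[OF p y(1) vy i]
    have "of_int (?M 0) * of_nat p - of_int (?N 0) * (y - of_nat (Suc i)) \<noteq> 0"
      using y(3) by (simp add: algebra_simps)
    then have "L ((- D, D) + v y *\<^sub>R (real p, real (Suc i))) \<in> reduced_amoeba ?n B v"
      unfolding L_def D_def ps(2)[symmetric] by (rule amoeba[rotated -1]) (use ps(1) in blast)+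
    then show "L (- D, D) + q *\<^sub>R L (real p, real (Suc i)) \<in> reduced_amoeba ?n B v"
      by (simp only: L_def lin2_add lin2_scaleR y(2))
  qed
  show "ray (L (D, - D)) (L (real (Suc i), real p)) \<subseteq> closure (reduced_amoeba ?n B v)"
  proof (rule ray_subset_closure)
    fix q :: real assume q: "q \<in> \<rat>" "0 < q"
    obtain y where y: "y \<noteq> 0" "v y = q"
      "- of_int (?M 0) * of_nat (Suc i) - of_int (?N 0) * of_nat p + of_int (?M 0) * y \<noteq> (0::'a)"
      using choose[OF q ab2] by blast
    have vy: "v y > 0" using y q by simp
    note ps = pencil_sums[OF p y(1) vy i]
    have "of_int (?M 0) * (y - of_nat (Suc i)) - of_int (?N 0) * of_nat p \<noteq> 0"
      using y(3) by (simp add: algebra_simps)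
    then have "L ((D, - D) + v y *\<^sub>R (real (Suc i), real p)) \<in> reduced_amoeba ?n B v"
      unfolding L_def D_def ps(3)[symmetric] by (rule amoeba[rotated -1]) (use ps(1) in blast)+
    then show "L (D, - D) + q *\<^sub>R L (real (Suc i), real p) \<in> reduced_amoeba ?n B v"
      by (simp only: L_def lin2_add lin2_scaleR y(2))
  qed
qed

lemma cone_at_slopes:
  assumes "x \<in> cone_at P (p, real (Suc i)) (p, real (Suc (Suc i)))" "0 < p"
  shows "real (Suc i) * (fst x - fst P) < p * (snd x - snd P)"
    "p * (snd x - snd P) < real (Suc (Suc i)) * (fst x - fst P)" "0 < fst x - fst P"
  using assms by (auto simp: cone_at_def algebra_simps add_pos_pos)

lemma disjoint_family_cones:
  assumes "0 < p"
  shows "disjoint_family (\<lambda>i. cone_at P (p, real (Suc i)) (p, real (Suc (Suc i))))"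
    and "disjoint_family (\<lambda>i. cone_at P (real (Suc i), p) (real (Suc (Suc i)), p))"
proof -
  have A: "i = j" if "x \<in> cone_at P (p, real (Suc i)) (p, real (Suc (Suc i)))"
    "x \<in> cone_at P (p, real (Suc j)) (p, real (Suc (Suc j)))" for x i j P
  proof -
    have "\<not> i < j" if i: "x \<in> cone_at P (p, real (Suc i)) (p, real (Suc (Suc i)))"
      "x \<in> cone_at P (p, real (Suc j)) (p, real (Suc (Suc j)))" for i j
    proof
      assume "i < j"
      then have "real (Suc (Suc i)) * (fst x - fst P) \<le> real (Suc j) * (fst x - fst P)"
        using cone_at_slopes(3)[OF i(1) assms] by (intro mult_right_mono) auto
      then show False using cone_at_slopes(2)[OF i(1) assms] cone_at_slopes(1)[OF i(2) assms] by linarith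
    qed
    then show ?thesis using that by (meson linorder_neqE_nat)
  qed
  then show "disjoint_family (\<lambda>i. cone_at P (p, real (Suc i)) (p, real (Suc (Suc i))))"
    unfolding disjoint_family_on_def by blast
  have sw: "prod.swap x \<in> cone_at (prod.swap P) (p, real (Suc i)) (p, real (Suc (Suc i)))"
    if "x \<in> cone_at P (real (Suc i), p) (real (Suc (Suc i)), p)" for x i
  proof -
    from that obtain s t where "x = P + s *\<^sub>R (real (Suc i), p) + t *\<^sub>R (real (Suc (Suc i)), p)"
      and st: "0 < s" "0 < t" unfolding cone_at_def by blast
    then have "prod.swap x = prod.swap P + s *\<^sub>R (p, real (Suc i)) + t *\<^sub>R (p, real (Suc (Suc i)))"
      by (cases P) simp
    then show ?thesis using st unfolding cone_at_def by blast
  qed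
  show "disjoint_family (\<lambda>i. cone_at P (real (Suc i), p) (real (Suc (Suc i)), p))"
    unfolding disjoint_family_on_def using A sw by blast
qed

lemma pencils_cones_meet:
  assumes "i + 1 < k" "j + 1 < k" "real k < p"
  defines "D \<equiv> p ^ 2 - real k * p"
  shows "cone_at (- D, D) (p, real (Suc i)) (p, real (Suc (Suc i))) \<inter>
    cone_at (D, - D) (real (Suc j), p) (real (Suc (Suc j)), p) \<noteq> {}"
proof -
  define a b where "a = 2 * real i + 3" and "b = 2 * real j + 3"
  define E where "E = 4 * p ^ 2 - a * b"
  have p: "p > 0" using assms(3) by (meson le_less_trans of_nat_0_le_iff)
  have D: "D > 0" using assms(3) p by (simp add: D_def power2_eq_square flip: left_diff_distrib)
  have "a < 2 * p" "b < 2 * p" "0 < a" "0 < b" using assms by (auto simp: a_def b_def)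
  then have "a * b < (2 * p) * (2 * p)" by (intro mult_strict_mono) auto
  then have E: "E > 0" by (simp add: E_def power2_eq_square)
  define s t where "s = 2 * D * (2 * p + b) / E" and "t = 2 * D * (2 * p + a) / E"
  have st: "s > 0" "t > 0" using D E p \<open>0 < a\<close> \<open>0 < b\<close> by (auto simp: s_def t_def)
  have sE: "s * E = 2 * D * (2 * p + b)" and tE: "t * E = 2 * D * (2 * p + a)"
    using E by (auto simp: s_def t_def)
  have "E * (s * (2 * p) - t * b) = (s * E) * (2 * p) - (t * E) * b" by (simp add: algebra_simps)
  also have "\<dots> = E * (2 * D)" unfolding sE tE by (simp add: E_def power2_eq_square algebra_simps)
  finally have 1: "s * (2 * p) - t * b = 2 * D" using E by simp
  have "E * (s * a - t * (2 * p)) = (s * E) * a - (t * E) * (2 * p)" by (simp add: algebra_simps)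
  also have "\<dots> = E * (- (2 * D))" unfolding sE tE by (simp add: E_def power2_eq_square algebra_simps)
  finally have 2: "s * a - t * (2 * p) = - (2 * D)"
    using E mult_left_cancel[of E] by (metis less_irrefl)
  let ?x = "(- D, D) + s *\<^sub>R (p, real (Suc i)) + s *\<^sub>R (p, real (Suc (Suc i)))"
  have "?x = (D, - D) + t *\<^sub>R (real (Suc j), p) + t *\<^sub>R (real (Suc (Suc j)), p)"
    using 1 2 by (simp add: a_def b_def algebra_simps)
  then have "?x \<in> cone_at (D, - D) (real (Suc j), p) (real (Suc (Suc j)), p)"
    unfolding cone_at_def using st by blast
  moreover have "?x \<in> cone_at (- D, D) (p, real (Suc i)) (p, real (Suc (Suc i)))"
    unfolding cone_at_def using st by blast
  ultimately show ?thesis by blast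
qed

lemma components_amoeba_pencils:
  fixes v :: "'k :: field_char_0 \<Rightarrow> real"
  assumes v: "padic_complex_field p v"
    and nb: "null_space_basis (2 * k + 1) (gale (2 * k + 1) (pencils p k)) B"
    and p: "(k + 2) ^ 2 < p"
  shows "\<exists>C \<subseteq> components (- closure (reduced_amoeba (2 * k + 1) B v)). finite C \<and> card C = (k - 1) ^ 2"
proof -
  interpret padic_complex_field p v by fact
  let ?K = "closure (reduced_amoeba (2 * k + 1) B v)"
  define M N where "M = (\<lambda>j. B $$ (2 * k + 2, j))" and "N = (\<lambda>j. B $$ (2 * k + 3, j))"
  define L where "L = lin2 M N"
  define D where "D = real p ^ 2 - real k * real p"
  define u w where "u i = (real p, real (Suc i))" and "w i = (real (Suc i), real p)" for i
  have r: "pencils p k (2 * k + 1 + 1) = (1, 0)" "pencils p k (2 * k + 1 + 2) = (0, 1)"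
    by (simp_all add: pencils_def)
  have idx: "2 * k + 1 + 1 = 2 * k + 2" "2 * k + 1 + 2 = 2 * k + 3" by simp_all
  have det: "M 0 * N 1 \<noteq> M 1 * N 0"
    unfolding M_def N_def by (rule null_space_basis_gale(2)[OF r pencils_sum_0 nb, unfolded idx])
  have "k < (k + 2) ^ 2" by (simp add: power2_eq_square)
  then have kp: "k < p" using p by linarith
  have p0: "0 < real p" using kp by simp
  have rays: "ray (L (- D, D)) (L (u i)) \<subseteq> ?K" "ray (L (D, - D)) (L (w i)) \<subseteq> ?K" if "i < k" for i
    using pencil_rays[OF nb p that] by (simp_all add: L_def M_def N_def D_def u_def w_def)
  have "real_of_int (M 0 * N 1 - M 1 * N 0) \<noteq> 0"
    using det by (simp only: of_int_eq_0_iff)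
  then have cr: "cross2 (L (u i)) (L (u (Suc i))) \<noteq> 0" "cross2 (L (w i)) (L (w (Suc i))) \<noteq> 0" for i
    unfolding L_def cross2_lin2 using p0 by (simp_all add: cross2_def u_def w_def algebra_simps)
  have inj: "inj L" unfolding L_def using det by (rule inj_lin2)
  have cone: "cone_at (L P) (L x) (L y) = L ` cone_at P x y" for P x y
    unfolding L_def by (rule cone_at_lin2)
  have disj: "disjoint_family_on (\<lambda>i. L ` C i) {..<k - 1}" if "disjoint_family C" for C :: "nat \<Rightarrow> _"
    using that inj unfolding disjoint_family_on_def by (metis UNIV_I image_Int image_empty)
  obtain gs Q where gs: "\<forall>(u, d) \<in> set gs. u \<noteq> 0" "?K \<subseteq> insert Q (- generic_pts gs)"
    by (rule closure_reduced_amoeba_lines[OF null_space_basis_col_sum[OF nb] null_space_basis_col_sum[OF nb]])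
      simp_all
  have "interior ?K = {}"
    using interior_mono[OF gs(2)] interior_lines_point_empty[OF gs(1), of Q] by simp
  then have "\<exists>C \<subseteq> components (- ?K). finite C \<and> card C = card {..<k - 1} ^ 2"
  proof (rule components_of_grid)
    fix i assume "i \<in> {..<k - 1}"
    then have ik: "i < k" "Suc i < k" by auto
    show "open (cone_at (L (- D, D)) (L (u i)) (L (u (Suc i))))"
      "open (cone_at (L (D, - D)) (L (w i)) (L (w (Suc i))))"
      using cr by (auto intro: open_cone_at)
    show "frontier (cone_at (L (- D, D)) (L (u i)) (L (u (Suc i)))) \<subseteq> ?K"
      using frontier_cone_at[OF cr(1)] rays(1)[OF ik(1)] rays(1)[OF ik(2)] by blast
    show "frontier (cone_at (L (D, - D)) (L (w i)) (L (w (Suc i)))) \<subseteq> ?K"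
      using frontier_cone_at[OF cr(2)] rays(2)[OF ik(1)] rays(2)[OF ik(2)] by blast
    fix j assume "j \<in> {..<k - 1}"
    then have "cone_at (- D, D) (u i) (u (Suc i)) \<inter> cone_at (D, - D) (w j) (w (Suc j)) \<noteq> {}"
      using pencils_cones_meet[of i k j "real p"] ik kp by (simp add: D_def u_def w_def)
    then show "cone_at (L (- D, D)) (L (u i)) (L (u (Suc i))) \<inter>
        cone_at (L (D, - D)) (L (w j)) (L (w (Suc j))) \<noteq> {}"
      unfolding cone by blast
  next
    show "disjoint_family_on (\<lambda>i. cone_at (L (- D, D)) (L (u i)) (L (u (Suc i)))) {..<k - 1}"
      unfolding cone u_def by (intro disj disjoint_family_cones p0)
    show "disjoint_family_on (\<lambda>i. cone_at (L (D, - D)) (L (w i)) (L (w (Suc i)))) {..<k - 1}"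
      unfolding cone w_def by (intro disj disjoint_family_cones p0)
  qed simp
  then show ?thesis by simp
qed

theorem theorem3:
  shows
    "(\<forall>(n :: nat) (a :: nat \<Rightarrow> int vec) (B :: int mat) (p :: nat) (v :: 'k :: field_char_0 \<Rightarrow> real).
        n \<ge> 1 \<and> is_support n a \<and> general_position n a \<and> null_space_basis n a B \<and>
        prime p \<and> padic_complex_field p v \<longrightarrow>
          finite (components (- closure (reduced_amoeba n B v))) \<and>
          card (components (- closure (reduced_amoeba n B v))) \<le> 2 * n ^ 2 + 9 * n + 11)
     \<and>
     (\<exists>(c :: real) (N :: nat set). c > 0 \<and> infinite N \<and>
        (\<forall>n\<in>N. n \<ge> 1 \<and>
          (\<exists>(a :: nat \<Rightarrow> int vec) (p :: nat). is_support n a \<and> prime p \<and>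
            (\<forall>(B :: int mat) (v :: 'k \<Rightarrow> real).
               null_space_basis n a B \<and> padic_complex_field p v \<longrightarrow>
               (\<exists>C \<subseteq> components (- closure (reduced_amoeba n B v)).
                  finite C \<and> real (card C) \<ge> c * real n ^ 2)))))"
proof (intro conjI)
  show "\<forall>(n :: nat) (a :: nat \<Rightarrow> int vec) (B :: int mat) (p :: nat) (v :: 'k :: field_char_0 \<Rightarrow> real).
        n \<ge> 1 \<and> is_support n a \<and> general_position n a \<and> null_space_basis n a B \<and>
        prime p \<and> padic_complex_field p v \<longrightarrow>
          finite (components (- closure (reduced_amoeba n B v))) \<and>
          card (components (- closure (reduced_amoeba n B v))) \<le> 2 * n ^ 2 + 9 * n + 11"
  proof (intro allI impI, elim conjE)
    fix n a B p and v :: "'k \<Rightarrow> real"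
    assume nb: "null_space_basis n a B" and v: "padic_complex_field p v"
    then show "finite (components (- closure (reduced_amoeba n B v))) \<and>
          card (components (- closure (reduced_amoeba n B v))) \<le> 2 * n ^ 2 + 9 * n + 11"
      by (rule card_components_amoeba_le[OF _ padic_complex_field.axioms(1)])
  qed
  show "\<exists>(c :: real) (N :: nat set). c > 0 \<and> infinite N \<and>
        (\<forall>n\<in>N. n \<ge> 1 \<and>
          (\<exists>(a :: nat \<Rightarrow> int vec) (p :: nat). is_support n a \<and> prime p \<and>
            (\<forall>(B :: int mat) (v :: 'k \<Rightarrow> real).
               null_space_basis n a B \<and> padic_complex_field p v \<longrightarrow>
               (\<exists>C \<subseteq> components (- closure (reduced_amoeba n B v)).
                  finite C \<and> real (card C) \<ge> c * real n ^ 2))))"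
  proof (intro exI[of _ "1 / 25"] exI[of _ "(\<lambda>k. 2 * k + 1) ` {2..}"] conjI ballI)
    show "infinite ((\<lambda>k. 2 * k + 1) ` {2::nat..})"
      by (subst finite_image_iff) (auto simp: inj_on_def infinite_Ici)
    fix n :: nat assume "n \<in> (\<lambda>k. 2 * k + 1) ` {2..}"
    then obtain k where k: "k \<ge> 2" "n = 2 * k + 1" by auto
    then show "n \<ge> 1" by simp
    obtain p where p: "prime p" "(k + 2) ^ 2 < p" using bigger_prime by blast
    have "1 < (k + 2) ^ 2" by (simp add: power2_eq_square)
    then have "1 < p" using p by linarith
    then have sup: "is_support n (gale n (pencils p k))"
      using k by (intro is_support_gale) (auto simp: pencils_def)
    have "(1 / 5 * real n) ^ 2 \<le> real (k - 1) ^ 2"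
      using k by (intro power_mono) (auto simp: of_nat_diff)
    then have "1 / 25 * real n ^ 2 \<le> real ((k - 1) ^ 2)"
      by (simp add: power_mult_distrib power_divide)
    then have "\<forall>(B :: int mat) (v :: 'k \<Rightarrow> real).
               null_space_basis n (gale n (pencils p k)) B \<and> padic_complex_field p v \<longrightarrow>
               (\<exists>C \<subseteq> components (- closure (reduced_amoeba n B v)).
                  finite C \<and> real (card C) \<ge> 1 / 25 * real n ^ 2)"
      using components_amoeba_pencils[where p = p and k = k] p k(2) by metis
    then show "\<exists>(a :: nat \<Rightarrow> int vec) (p :: nat). is_support n a \<and> prime p \<and>
            (\<forall>(B :: int mat) (v :: 'k \<Rightarrow> real).
               null_space_basis n a B \<and> padic_complex_field p v \<longrightarrow>
               (\<exists>C \<subseteq> components (- closure (reduced_amoeba n B v)).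
                  finite C \<and> real (card C) \<ge> 1 / 25 * real n ^ 2))"
      using sup p by blast
  qed simp
qed

end
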